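(* Let $\mathcal M=(M,<,\ldots)$ be a definably complete locally o-minimal structure. Let $D\subseteq M^n$ be a definable discrete set and let $\pi:M^n\to M^d$ be a coordinate projection. Then $\pi(D)$ is discrete.
   Context: Here $\mathcal M=(M,<,\ldots)$ is a structure expanding a dense linear order without endpoints. "Definable" means definable in $\mathcal M$ with parameters. An open interval is a set $(a,b)=\{x\in M : a<x<b\}$ with $a<b$ in $M$. $M$ carries the order topology and $M^n$ the product topology. A set is discrete if its subspace topology is discrete. A coordinate projection $M^n\to M^d$ is a projection onto some $d$ of the $n$ coordinates. $\mathcal M$ is locally o-minimal if for every definable $X\subseteq M$ and every $a\in M$ there is an open interval $I$ containing $a$ such that $X\cap I$ is a finite union of points and open intervals. $\mathcal M$ is definably complete if every definable subset of $M$ has a supremum and an infimum in $M\cup\{\pm\infty\}$. *)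

theory Defs
  imports "HOL-Analysis.Analysis" "HOL-Library.Extended" "HOL-Library.Lub_Glb"
begin

(* First-order structures (M,<,...).  The universe M is the whole type 'a, and the symbol < is
   the order of 'a; it is a logical primitive of the formulas below (as is equality), so it does
   not occur among the symbols of the structure.  The arity is None for elements of 'f and 'r
   that are not symbols of the language; in this way the language may lack, for instance,
   function symbols altogether, although HOL types are non-empty. *)

record ('a, 'f, 'r) fo_structure =
  fun_arity :: "'f \<Rightarrow> nat option"
  rel_arity :: "'r \<Rightarrow> nat option"
  fun_interp :: "'f \<Rightarrow> 'a list \<Rightarrow> 'a"
  rel_interp :: "'r \<Rightarrow> 'a list \<Rightarrow> bool"

datatype 'f fo_term =
    Var nat
  | App 'f "'f fo_term list"

datatype ('f, 'r) fo_formula =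
    EqF "'f fo_term" "'f fo_term"
  | LessF "'f fo_term" "'f fo_term"
  | RelF 'r "'f fo_term list"
  | NegF "('f, 'r) fo_formula"
  | AndF "('f, 'r) fo_formula" "('f, 'r) fo_formula"
  | ExF nat "('f, 'r) fo_formula"

fun wf_term :: "('a, 'f, 'r) fo_structure \<Rightarrow> 'f fo_term \<Rightarrow> bool" where
  "wf_term \<M> (Var i) = True"
| "wf_term \<M> (App f ts) = (fun_arity \<M> f = Some (length ts) \<and> (\<forall>t\<in>set ts. wf_term \<M> t))"

fun wf_formula :: "('a, 'f, 'r) fo_structure \<Rightarrow> ('f, 'r) fo_formula \<Rightarrow> bool" where
  "wf_formula \<M> (EqF s t) = (wf_term \<M> s \<and> wf_term \<M> t)"
| "wf_formula \<M> (LessF s t) = (wf_term \<M> s \<and> wf_term \<M> t)"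
| "wf_formula \<M> (RelF r ts) = (rel_arity \<M> r = Some (length ts) \<and> (\<forall>t\<in>set ts. wf_term \<M> t))"
| "wf_formula \<M> (NegF \<phi>) = wf_formula \<M> \<phi>"
| "wf_formula \<M> (AndF \<phi> \<psi>) = (wf_formula \<M> \<phi> \<and> wf_formula \<M> \<psi>)"
| "wf_formula \<M> (ExF i \<phi>) = wf_formula \<M> \<phi>"

fun term_val :: "('a, 'f, 'r) fo_structure \<Rightarrow> (nat \<Rightarrow> 'a) \<Rightarrow> 'f fo_term \<Rightarrow> 'a" where
  "term_val \<M> v (Var i) = v i"
| "term_val \<M> v (App f ts) = fun_interp \<M> f (map (term_val \<M> v) ts)"

fun sat :: "('a::linorder, 'f, 'r) fo_structure \<Rightarrow> (nat \<Rightarrow> 'a) \<Rightarrow> ('f, 'r) fo_formula \<Rightarrow> bool" where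
  "sat \<M> v (EqF s t) = (term_val \<M> v s = term_val \<M> v t)"
| "sat \<M> v (LessF s t) = (term_val \<M> v s < term_val \<M> v t)"
| "sat \<M> v (RelF r ts) = rel_interp \<M> r (map (term_val \<M> v) ts)"
| "sat \<M> v (NegF \<phi>) = (\<not> sat \<M> v \<phi>)"
| "sat \<M> v (AndF \<phi> \<psi>) = (sat \<M> v \<phi> \<and> sat \<M> v \<psi>)"
| "sat \<M> v (ExF i \<phi>) = (\<exists>a. sat \<M> (v(i := a)) \<phi>)"

(* M^n: a tuple is a function on {..<n}, extended by undefined outside {..<n}. *)

definition tuples :: "nat \<Rightarrow> (nat \<Rightarrow> 'a) set" where
  "tuples n = {..<n} \<rightarrow>\<^sub>E UNIV"

(* Definability with parameters: the variables with index < n stand for the coordinates, and all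
   other free variables are evaluated to the parameters c.  A formula has only finitely many free
   variables, so only finitely many parameters matter. *)

definition definable ::
  "('a::linorder, 'f, 'r) fo_structure \<Rightarrow> nat \<Rightarrow> (nat \<Rightarrow> 'a) set \<Rightarrow> bool" where
  "definable \<M> n X \<longleftrightarrow>
     (\<exists>\<phi> c. wf_formula \<M> \<phi> \<and>
        X = {x \<in> tuples n. sat \<M> (\<lambda>i. if i < n then x i else c i) \<phi>})"

(* Subsets of M itself, identified with subsets of M^1. *)

definition definable_subset :: "('a::linorder, 'f, 'r) fo_structure \<Rightarrow> 'a set \<Rightarrow> bool" where
  "definable_subset \<M> X \<longleftrightarrow> definable \<M> 1 {x \<in> tuples 1. x 0 \<in> X}"

definition open_interval :: "'a::linorder set \<Rightarrow> bool" where
  "open_interval I \<longleftrightarrow> (\<exists>a b. a < b \<and> I = {a<..<b})"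

definition locally_o_minimal :: "('a::linorder, 'f, 'r) fo_structure \<Rightarrow> bool" where
  "locally_o_minimal \<M> \<longleftrightarrow>
     (\<forall>X a. definable_subset \<M> X \<longrightarrow>
        (\<exists>I. open_interval I \<and> a \<in> I \<and>
           (\<exists>\<C>. finite \<C> \<and> (\<forall>C\<in>\<C>. (\<exists>p. C = {p}) \<or> open_interval C) \<and> X \<inter> I = \<Union>\<C>)))"

(* The type 'a extended is M together with -\<infinity> and +\<infinity>. *)

definition definably_complete :: "('a::linorder, 'f, 'r) fo_structure \<Rightarrow> bool" where
  "definably_complete \<M> \<longleftrightarrow>
     (\<forall>X. definable_subset \<M> X \<longrightarrow>
        (\<exists>s :: 'a extended. isLub UNIV (Fin ` X) s) \<and>
        (\<exists>s :: 'a extended. isGlb UNIV (Fin ` X) s))"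

definition tuple_topology :: "nat \<Rightarrow> (nat \<Rightarrow> 'a::topological_space) topology" where
  "tuple_topology n = product_topology (\<lambda>_. euclidean) {..<n}"

definition discrete_subset :: "nat \<Rightarrow> (nat \<Rightarrow> 'a::topological_space) set \<Rightarrow> bool" where
  "discrete_subset n D \<longleftrightarrow> subtopology (tuple_topology n) D = discrete_topology D"

(* \<sigma> selects d distinct coordinates, listed in any order. *)

definition coordinate_projection ::
  "nat \<Rightarrow> nat \<Rightarrow> ((nat \<Rightarrow> 'a) \<Rightarrow> (nat \<Rightarrow> 'a)) \<Rightarrow> bool" where
  "coordinate_projection n d \<pi> \<longleftrightarrow>
     (\<exists>\<sigma>. inj_on \<sigma> {..<d} \<and> \<sigma> ` {..<d} \<subseteq> {..<n} \<and>
        (\<forall>x\<in>tuples n. \<pi> x = (\<lambda>j\<in>{..<d}. x (\<sigma> j))))"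

end

theory Submission
  imports Defs
begin

text \<open>By definable completeness and local o-minimality, a definable subset of \<open>M\<close> without interior is
  closed and discrete, and has a least element beyond any point that it exceeds.  A definable
  union of such thin sets indexed by a thin set is thin: by induction along the index set this
  reduces to increasing families, and if an increasing family of thin sets filled an interval,
  then for \<open>x\<close> inside it the first points after \<open>x\<close> of its members would fill a germ at \<open>x\<close>; but
  then one member would contain an interval.

  If a coordinate projection of \<open>D\<close> contained an interval, then after passing to a definable section
  some other coordinate \<open>f\<close>, as a function of the first, would jump in the same direction to
  the right of each point of an interval, say \<open>f(x') \<ge> w > f(x)\<close> for \<open>x'\<close> slightly larger than \<open>x\<close>.
  The set \<open>J_w\<close> of all \<open>x\<close> that jump across \<open>w\<close> is thin, hence so is its image \<open>f(J_w)\<close>.  The first-point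
  argument applied to the family \<open>f(J_w)\<close> shows that the union of these images, the image of \<open>f\<close>,
  is thin, although \<open>f\<close> has thin fibres and an interval as its domain.\<close>

section \<open>Definable predicates on environments\<close>

fun rename_term :: "(nat \<Rightarrow> nat) \<Rightarrow> 'f fo_term \<Rightarrow> 'f fo_term" where
  "rename_term \<rho> (Var i) = Var (\<rho> i)"
| "rename_term \<rho> (App f ts) = App f (map (rename_term \<rho>) ts)"

fun rename_formula :: "(nat \<Rightarrow> nat) \<Rightarrow> ('f, 'r) fo_formula \<Rightarrow> ('f, 'r) fo_formula" where
  "rename_formula \<rho> (EqF s t) = EqF (rename_term \<rho> s) (rename_term \<rho> t)"
| "rename_formula \<rho> (LessF s t) = LessF (rename_term \<rho> s) (rename_term \<rho> t)"
| "rename_formula \<rho> (RelF r ts) = RelF r (map (rename_term \<rho>) ts)"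
| "rename_formula \<rho> (NegF \<phi>) = NegF (rename_formula \<rho> \<phi>)"
| "rename_formula \<rho> (AndF \<phi> \<psi>) = AndF (rename_formula \<rho> \<phi>) (rename_formula \<rho> \<psi>)"
| "rename_formula \<rho> (ExF i \<phi>) = ExF (\<rho> i) (rename_formula \<rho> \<phi>)"

lemma wf_rename_term [simp]: "wf_term \<M> (rename_term \<rho> t) = wf_term \<M> t"
  by (induction t) auto

lemma wf_rename_formula [simp]: "wf_formula \<M> (rename_formula \<rho> \<phi>) = wf_formula \<M> \<phi>"
  by (induction \<phi>) auto

lemma term_val_rename [simp]: "term_val \<M> v (rename_term \<rho> t) = term_val \<M> (\<lambda>i. v (\<rho> i)) t"
proof (induction t)
  case (App f ts)
  then have "map (term_val \<M> v \<circ> rename_term \<rho>) ts = map (term_val \<M> (\<lambda>i. v (\<rho> i))) ts"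
    by simp
  then show ?case by (simp del: map_eq_conv)
qed simp

text \<open>Bound variables are renamed as well; injectivity keeps an update at
  \<open>\<rho> i\<close> from affecting any variable other than \<open>i\<close>.\<close>

lemma sat_rename:
  assumes "inj \<rho>"
  shows "sat \<M> v (rename_formula \<rho> \<phi>) = sat \<M> (\<lambda>i. v (\<rho> i)) \<phi>"
proof (induction \<phi> arbitrary: v)
  case (ExF i \<phi>)
  have "(\<lambda>j. (v(\<rho> i := a)) (\<rho> j)) = (\<lambda>j. v (\<rho> j))(i := a)" for a
    using assms by (auto simp: fun_eq_iff inj_eq)
  then show ?case using ExF by (simp del: fun_upd_apply)
qed (auto simp: comp_def)

lemma term_val_finite_support:
  "\<exists>N. \<forall>v v'. (\<forall>i<N. v i = v' i) \<longrightarrow> term_val \<M> v t = term_val \<M> v' t"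
proof (induction t)
  case (Var i)
  show ?case by (rule exI[of _ "Suc i"]) auto
next
  case (App f ts)
  then obtain N where N: "\<And>t v v'. t \<in> set ts \<Longrightarrow> \<forall>i<N t. v i = v' i \<Longrightarrow>
      term_val \<M> v t = term_val \<M> v' t"
    by metis
  have "term_val \<M> v (App f ts) = term_val \<M> v' (App f ts)"
    if "\<forall>i < Max (insert 0 (N ` set ts)). v i = v' i" for v v'
  proof -
    have "term_val \<M> v t = term_val \<M> v' t" if t: "t \<in> set ts" for t
    proof (rule N[OF t])
      have "N t \<le> Max (insert 0 (N ` set ts))" using t by simp
      then show "\<forall>i<N t. v i = v' i"
        using \<open>\<forall>i < Max (insert 0 (N ` set ts)). v i = v' i\<close> by auto
    qed
    then have "map (term_val \<M> v) ts = map (term_val \<M> v') ts" by simp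
    then show ?thesis by (simp del: map_eq_conv)
  qed
  then show ?case by blast
qed

lemma sat_finite_support:
  "\<exists>N. \<forall>v v'. (\<forall>i<N. v i = v' i) \<longrightarrow> sat \<M> v \<phi> = sat \<M> v' \<phi>"
proof (induction \<phi>)
  case (EqF s t)
  obtain N where N: "\<And>v v'. \<forall>i<N. v i = v' i \<Longrightarrow> term_val \<M> v s = term_val \<M> v' s"
    using term_val_finite_support by metis
  obtain N' where N': "\<And>v v'. \<forall>i<N'. v i = v' i \<Longrightarrow> term_val \<M> v t = term_val \<M> v' t"
    using term_val_finite_support by metis
  have "sat \<M> v (EqF s t) = sat \<M> v' (EqF s t)" if "\<forall>i<max N N'. v i = v' i" for v v'
    using that N[of v v'] N'[of v v'] by simp
  then show ?case by blast
next
  case (LessF s t)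
  obtain N where N: "\<And>v v'. \<forall>i<N. v i = v' i \<Longrightarrow> term_val \<M> v s = term_val \<M> v' s"
    using term_val_finite_support by metis
  obtain N' where N': "\<And>v v'. \<forall>i<N'. v i = v' i \<Longrightarrow> term_val \<M> v t = term_val \<M> v' t"
    using term_val_finite_support by metis
  have "sat \<M> v (LessF s t) = sat \<M> v' (LessF s t)" if "\<forall>i<max N N'. v i = v' i" for v v'
    using that N[of v v'] N'[of v v'] by simp
  then show ?case by blast
next
  case (RelF r ts)
  obtain N where N: "\<And>t v v'. \<forall>i<N t. v i = v' i \<Longrightarrow> term_val \<M> v t = term_val \<M> v' t"
    using term_val_finite_support by metis
  have "sat \<M> v (RelF r ts) = sat \<M> v' (RelF r ts)"
    if "\<forall>i < Max (insert 0 (N ` set ts)). v i = v' i" for v v'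
  proof -
    have "term_val \<M> v t = term_val \<M> v' t" if t: "t \<in> set ts" for t
    proof (rule N)
      have "N t \<le> Max (insert 0 (N ` set ts))" using t by simp
      then show "\<forall>i<N t. v i = v' i"
        using \<open>\<forall>i < Max (insert 0 (N ` set ts)). v i = v' i\<close> by auto
    qed
    then have "map (term_val \<M> v) ts = map (term_val \<M> v') ts" by simp
    then show ?thesis by (simp del: map_eq_conv)
  qed
  then show ?case by blast
next
  case (NegF \<phi>)
  then show ?case by simp
next
  case (AndF \<phi> \<psi>)
  obtain N where N: "\<And>v v'. \<forall>i<N. v i = v' i \<Longrightarrow> sat \<M> v \<phi> = sat \<M> v' \<phi>"
    using AndF.IH(1) by metis
  obtain N' where N': "\<And>v v'. \<forall>i<N'. v i = v' i \<Longrightarrow> sat \<M> v \<psi> = sat \<M> v' \<psi>"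
    using AndF.IH(2) by metis
  have "sat \<M> v (AndF \<phi> \<psi>) = sat \<M> v' (AndF \<phi> \<psi>)" if "\<forall>i<max N N'. v i = v' i" for v v'
    using that N[of v v'] N'[of v v'] by simp
  then show ?case by blast
next
  case (ExF i \<phi>)
  then obtain N where N: "\<forall>v v'. (\<forall>i<N. v i = v' i) \<longrightarrow> sat \<M> v \<phi> = sat \<M> v' \<phi>"
    by blast
  have "sat \<M> (v(i := a)) \<phi> = sat \<M> (v'(i := a)) \<phi>" if "\<forall>i<N. v i = v' i" for v v' a
    using N that by simp
  then have "\<forall>v v'. (\<forall>i<N. v i = v' i) \<longrightarrow> sat \<M> v (ExF i \<phi>) = sat \<M> v' (ExF i \<phi>)"
    by (metis sat.simps(6))
  then show ?case by blast
qed

text \<open>Each quantifier comes with an equation that determines its witness, so the block just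
  overwrites the listed variables. Since \<open>m\<close> is not listed, its value survives all the
  updates.\<close>

lemma sat_identify_vars:
  fixes \<M> :: "('a::linorder, 'f, 'r) fo_structure"
  assumes "m \<notin> set is"
  shows "sat \<M> v (foldr (\<lambda>i \<psi>. ExF i (AndF (EqF (Var i) (Var m)) \<psi>)) is \<phi>) =
    sat \<M> (\<lambda>j. if j \<in> set is then v m else v j) \<phi>"
  using assms
proof (induction "is" arbitrary: v)
  case (Cons i "is")
  have "(\<lambda>j. if j \<in> set is then (v(i := v m)) m else (v(i := v m)) j) =
      (\<lambda>j. if j \<in> set (i # is) then v m else v j)"
    using Cons.prems by (auto simp: fun_eq_iff)
  moreover have "(\<exists>a. a = v m \<and> Q a) = Q (v m)" for Q by blast
  ultimately show ?case using Cons by simp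
qed simp

text \<open>Serves quantification in \<open>def_pred_ex\<close>: a formula may read one position of
  the environment through several variables, and one quantifier must bind them all. The variables in
  \<open>S\<close> are merged into variable 0 and the others move up by one. Finite support leaves
  only finitely many variables to merge, even if \<open>S\<close> is infinite.\<close>

lemma formula_identify_vars:
  fixes \<M> :: "('a::linorder, 'f, 'r) fo_structure"
  assumes "wf_formula \<M> \<phi>"
  obtains \<phi>' where "wf_formula \<M> \<phi>'"
    "\<And>v a. sat \<M> (\<lambda>i. if i \<in> S then a else v i) \<phi> = sat \<M> (case_nat a v) \<phi>'"
proof -
  obtain N where N: "\<And>v v'. \<forall>i<N. v i = v' i \<Longrightarrow> sat \<M> v \<phi> = sat \<M> v' \<phi>"
    using sat_finite_support by metis
  define js where "js = map Suc (filter (\<lambda>i. i \<in> S) [0..<N])"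
  define ident where "ident = (\<lambda>i (\<psi>::('f,'r) fo_formula). ExF i (AndF (EqF (Var i) (Var 0)) \<psi>))"
  define \<phi>' where "\<phi>' = foldr ident js (rename_formula Suc \<phi>)"
  have "wf_formula \<M> (foldr ident is \<psi>) = wf_formula \<M> \<psi>" for "is" \<psi>
    by (induction "is") (auto simp: ident_def)
  then have "wf_formula \<M> \<phi>'" using assms by (simp add: \<phi>'_def)
  moreover have "sat \<M> (\<lambda>i. if i \<in> S then a else v i) \<phi> = sat \<M> (case_nat a v) \<phi>'" for v a
  proof -
    have "0 \<notin> set js" by (simp add: js_def)
    from sat_identify_vars[OF this, of \<M> "case_nat a v" "rename_formula Suc \<phi>"]
    have "sat \<M> (case_nat a v) \<phi>' =
        sat \<M> (\<lambda>i. (\<lambda>j. if j \<in> set js then a else case_nat a v j) (Suc i)) \<phi>"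
      by (simp add: \<phi>'_def ident_def sat_rename cong: if_cong)
    also have "\<dots> = sat \<M> (\<lambda>i. if i \<in> S then a else v i) \<phi>"
      by (rule N) (auto simp: js_def)
    finally show ?thesis by simp
  qed
  ultimately show ?thesis using that by blast
qed

text \<open>Each variable of the formula is read off from the environment \<open>v\<close> or is a parameter;
  several variables may be read off from the same position, which makes substitution trivial.\<close>

definition env_val :: "(nat \<Rightarrow> nat + 'a) \<Rightarrow> (nat \<Rightarrow> 'a) \<Rightarrow> nat \<Rightarrow> 'a" where
  "env_val e v i = (case e i of Inl j \<Rightarrow> v j | Inr a \<Rightarrow> a)"

definition def_pred :: "('a::linorder, 'f, 'r) fo_structure \<Rightarrow> ((nat \<Rightarrow> 'a) \<Rightarrow> bool) \<Rightarrow> bool" where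
  "def_pred \<M> P \<longleftrightarrow> (\<exists>\<phi> e. wf_formula \<M> \<phi> \<and> (\<forall>v. P v = sat \<M> (env_val e v) \<phi>))"

definition var_or_const :: "((nat \<Rightarrow> 'a) \<Rightarrow> 'a) \<Rightarrow> bool" where
  "var_or_const t \<longleftrightarrow> (\<exists>x. t = (\<lambda>v. case x of Inl j \<Rightarrow> v j | Inr a \<Rightarrow> a))"

text \<open>Through \<open>restrict\<close>, a predicate on infinite environments speaks about the
  first \<open>n\<close> positions only.\<close>

definition def_tuples ::
  "('a::linorder, 'f, 'r) fo_structure \<Rightarrow> nat \<Rightarrow> (nat \<Rightarrow> 'a) set \<Rightarrow> bool" where
  "def_tuples \<M> n D \<longleftrightarrow> D \<subseteq> tuples n \<and> def_pred \<M> (\<lambda>v. restrict v {..<n} \<in> D)"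

section \<open>Closure of definable predicates under the logical operations\<close>

lemma var_or_const_var: "var_or_const (\<lambda>v. v i)"
  unfolding var_or_const_def by (rule exI[of _ "Inl i"]) simp

lemma var_or_const_const: "var_or_const (\<lambda>v. c)"
  unfolding var_or_const_def by (rule exI[of _ "Inr c"]) simp

lemma var_or_const_restrict:
  "i < n \<Longrightarrow> var_or_const (\<lambda>v. restrict (\<lambda>k. v (\<rho> k)) {..<n} i)"
  by (simp add: var_or_const_var)

text \<open>Only the assignment of positions and parameters to variables changes; the formula stays
  the same, so no capture can occur.\<close>

lemma def_pred_subst:
  assumes "def_pred \<M> P" and "\<And>k. var_or_const (s k)"
  shows "def_pred \<M> (\<lambda>v. P (\<lambda>k. s k v))"
proof -
  obtain \<phi> e where wf: "wf_formula \<M> \<phi>" and P: "\<And>v. P v = sat \<M> (env_val e v) \<phi>"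
    using assms(1) unfolding def_pred_def by blast
  obtain x where x: "\<And>k. s k = (\<lambda>v. case x k of Inl j \<Rightarrow> v j | Inr a \<Rightarrow> a)"
    using assms(2) unfolding var_or_const_def by metis
  define e' where "e' = (\<lambda>i. case e i of Inl k \<Rightarrow> x k | Inr a \<Rightarrow> Inr a)"
  have "env_val e (\<lambda>k. s k v) = env_val e' v" for v
    by (auto simp: fun_eq_iff env_val_def e'_def x split: sum.splits)
  then show ?thesis unfolding def_pred_def using wf P by auto
qed

lemma def_pred_not: "def_pred \<M> P \<Longrightarrow> def_pred \<M> (\<lambda>v. \<not> P v)"
  unfolding def_pred_def by (metis sat.simps(4) wf_formula.simps(4))

lemma def_pred_and:
  assumes "def_pred \<M> P" "def_pred \<M> Q"
  shows "def_pred \<M> (\<lambda>v. P v \<and> Q v)"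
proof -
  obtain \<phi> e where \<phi>: "wf_formula \<M> \<phi>" "\<And>v. P v = sat \<M> (env_val e v) \<phi>"
    using assms(1) unfolding def_pred_def by blast
  obtain \<psi> e' where \<psi>: "wf_formula \<M> \<psi>" "\<And>v. Q v = sat \<M> (env_val e' v) \<psi>"
    using assms(2) unfolding def_pred_def by blast
  \<comment> \<open>Even variables carry \<open>P\<close> and odd variables carry \<open>Q\<close>,
    so that the two formulas keep separate parameters.\<close>
  define e'' where "e'' = (\<lambda>i. if even i then e (i div 2) else e' (i div 2))"
  have "(\<lambda>i. env_val e'' v (2 * i)) = env_val e v"
    "(\<lambda>i. env_val e'' v (Suc (2 * i))) = env_val e' v" for v
    by (auto simp: fun_eq_iff env_val_def e''_def)
  moreover have "inj (\<lambda>i::nat. 2 * i)" "inj (\<lambda>i::nat. Suc (2 * i))"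
    by (auto simp: inj_def)
  ultimately have "(P v \<and> Q v) = sat \<M> (env_val e'' v)
      (AndF (rename_formula (\<lambda>i. 2 * i) \<phi>) (rename_formula (\<lambda>i. Suc (2 * i)) \<psi>))" for v
    using \<phi> \<psi> by (simp add: sat_rename)
  then show ?thesis unfolding def_pred_def using \<phi>(1) \<psi>(1)
    by (intro exI[of _ "AndF (rename_formula (\<lambda>i. 2 * i) \<phi>) (rename_formula (\<lambda>i. Suc (2 * i)) \<psi>)"]
        exI[of _ e'']) simp
qed

lemma def_pred_ex:
  fixes \<M> :: "('a::linorder, 'f, 'r) fo_structure"
  assumes "def_pred \<M> (\<lambda>v. Q (v 0) (\<lambda>k. v (Suc k)))"
  shows "def_pred \<M> (\<lambda>v. \<exists>a. Q a v)"
proof -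
  obtain \<phi> e where \<phi>: "wf_formula \<M> \<phi>"
    and Q: "\<And>v. Q (v 0) (\<lambda>k. v (Suc k)) = sat \<M> (env_val e v) \<phi>"
    using assms unfolding def_pred_def by blast
  obtain \<phi>' where \<phi>': "wf_formula \<M> \<phi>'"
    "\<And>v a. sat \<M> (\<lambda>i. if i \<in> {i. e i = Inl 0} then a else v i) \<phi> = sat \<M> (case_nat a v) \<phi>'"
    using formula_identify_vars[OF \<phi>, of "{i. e i = Inl 0}"] by blast
  \<comment> \<open>The new quantifier overwrites variable 0, hence the arbitrary default. Positions
    drop by one; the truncated \<open>0 - 1\<close> arises only for variables that have been merged
    into variable 0.\<close>
  define e' where "e' = (\<lambda>i. case i of 0 \<Rightarrow> Inr undefined |
    Suc i \<Rightarrow> (case e i of Inl j \<Rightarrow> Inl (j - 1) | Inr a \<Rightarrow> Inr a))"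
  have "Q a v = sat \<M> ((env_val e' v)(0 := a)) \<phi>'" for a v
  proof -
    have "Q a v = sat \<M> (env_val e (case_nat a v)) \<phi>" using Q[of "case_nat a v"] by simp
    also have "env_val e (case_nat a v) =
        (\<lambda>i. if i \<in> {i. e i = Inl 0} then a else env_val e' v (Suc i))"
      by (auto simp: fun_eq_iff env_val_def e'_def split: sum.splits nat.splits)
    also have "sat \<M> \<dots> \<phi> = sat \<M> (case_nat a (\<lambda>i. env_val e' v (Suc i))) \<phi>'" by (rule \<phi>'(2))
    also have "case_nat a (\<lambda>i. env_val e' v (Suc i)) = (env_val e' v)(0 := a)"
      by (auto simp: fun_eq_iff split: nat.splits)
    finally show ?thesis .
  qed
  then show ?thesis unfolding def_pred_def using \<phi>'(1)
    by (intro exI[of _ "ExF 0 \<phi>'"] exI[of _ e']) simp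
qed

lemma def_pred_or: "def_pred \<M> P \<Longrightarrow> def_pred \<M> Q \<Longrightarrow> def_pred \<M> (\<lambda>v. P v \<or> Q v)"
  using def_pred_not[OF def_pred_and[OF def_pred_not def_pred_not], of \<M> P Q] by simp

lemma def_pred_imp:
  assumes "def_pred \<M> P" "def_pred \<M> Q"
  shows "def_pred \<M> (\<lambda>v. P v \<longrightarrow> Q v)"
  unfolding imp_conv_disj by (intro def_pred_or def_pred_not assms)

lemma def_pred_all:
  assumes "def_pred \<M> (\<lambda>v. Q (v 0) (\<lambda>k. v (Suc k)))"
  shows "def_pred \<M> (\<lambda>v. \<forall>a. Q a v)"
proof -
  have "def_pred \<M> (\<lambda>v. \<not> (\<exists>a. \<not> Q a v))"
    by (intro def_pred_not def_pred_ex assms)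
  then show ?thesis by simp
qed

lemma def_pred_binary:
  "def_pred \<M> (\<lambda>v. R (v 0) (v (Suc 0))) \<Longrightarrow> var_or_const s \<Longrightarrow> var_or_const t \<Longrightarrow>
    def_pred \<M> (\<lambda>v. R (s v) (t v))"
  using def_pred_subst[of \<M> "\<lambda>v. R (v 0) (v (Suc 0))" "case_nat s (\<lambda>_. t)"]
  by (simp split: nat.splits)

lemma def_pred_mem:
  "def_pred \<M> (\<lambda>v. v 0 \<in> A) \<Longrightarrow> var_or_const s \<Longrightarrow> def_pred \<M> (\<lambda>v. s v \<in> A)"
  using def_pred_subst[of \<M> "\<lambda>v. v 0 \<in> A" "\<lambda>_. s"] by simp

lemma def_pred_less:
  assumes "var_or_const s" "var_or_const t"
  shows "def_pred \<M> (\<lambda>v. s v < t v)"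
proof (rule def_pred_binary[OF _ assms])
  show "def_pred \<M> (\<lambda>v. v 0 < v (Suc 0))" unfolding def_pred_def
    by (intro exI[of _ "LessF (Var 0) (Var (Suc 0))"] exI[of _ Inl]) (simp add: env_val_def)
qed

lemma def_pred_eq:
  assumes "var_or_const s" "var_or_const t"
  shows "def_pred \<M> (\<lambda>v. s v = t v)"
proof (rule def_pred_binary[OF _ assms])
  show "def_pred \<M> (\<lambda>v. v 0 = v (Suc 0))" unfolding def_pred_def
    by (intro exI[of _ "EqF (Var 0) (Var (Suc 0))"] exI[of _ Inl]) (simp add: env_val_def)
qed

lemma def_pred_le:
  "var_or_const s \<Longrightarrow> var_or_const t \<Longrightarrow> def_pred \<M> (\<lambda>v. s v \<le> t v)"
  using def_pred_not[OF def_pred_less, of t s \<M>] by (simp add: not_less)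

lemma def_pred_ex_many:
  "def_pred \<M> P \<Longrightarrow> def_pred \<M> (\<lambda>v. \<exists>z. P (\<lambda>k. if k < n then z k else v (k - n)))"
proof (induction n arbitrary: P)
  case (Suc n)
  define P' where "P' = (\<lambda>v. \<exists>a. P (case_nat a v))"
  have "(\<lambda>v. P (case_nat (v 0) (\<lambda>k. v (Suc k)))) = P"
  proof
    fix v :: "nat \<Rightarrow> 'a"
    have "case_nat (v 0) (\<lambda>k. v (Suc k)) = v" by (auto simp: fun_eq_iff split: nat.splits)
    then show "P (case_nat (v 0) (\<lambda>k. v (Suc k))) = P v" by simp
  qed
  then have "def_pred \<M> P'" unfolding P'_def using Suc.prems by (intro def_pred_ex) simp
  then have "def_pred \<M> (\<lambda>v. \<exists>z. P' (\<lambda>k. if k < n then z k else v (k - n)))" by (rule Suc.IH)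
  moreover have "(\<exists>z. P' (\<lambda>k. if k < n then z k else v (k - n))) =
      (\<exists>z. P (\<lambda>k. if k < Suc n then z k else v (k - Suc n)))" for v
  proof -
    have eq: "case_nat (z 0) (\<lambda>k. if k < n then z (Suc k) else v (k - n)) =
        (\<lambda>k. if k < Suc n then z k else v (k - Suc n))" for z
      by (auto simp: fun_eq_iff split: nat.splits)
    show ?thesis
    proof
      assume "\<exists>z. P' (\<lambda>k. if k < n then z k else v (k - n))"
      then obtain z a where "P (case_nat a (\<lambda>k. if k < n then z k else v (k - n)))"
        unfolding P'_def by blast
      then show "\<exists>z. P (\<lambda>k. if k < Suc n then z k else v (k - Suc n))"
        using eq[of "case_nat a z"] by (intro exI[of _ "case_nat a z"]) (simp cong: if_cong)
    next
      assume "\<exists>z. P (\<lambda>k. if k < Suc n then z k else v (k - Suc n))"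
      then obtain z where "P (\<lambda>k. if k < Suc n then z k else v (k - Suc n))" by blast
      then show "\<exists>z. P' (\<lambda>k. if k < n then z k else v (k - n))"
        unfolding P'_def using eq[of z]
        by (intro exI[of _ "\<lambda>k. z (Suc k)"] exI[of _ "z 0"]) simp
    qed
  qed
  ultimately show ?case by simp
qed simp

lemma def_pred_tuple_mem:
  assumes "def_tuples \<M> n D"
  shows "def_pred \<M> (\<lambda>v. restrict (\<lambda>k. v (\<rho> k)) {..<n} \<in> D)"
  using assms def_pred_subst[of \<M> "\<lambda>v. restrict v {..<n} \<in> D" "\<lambda>k v. v (\<rho> k)"]
  by (simp add: def_tuples_def var_or_const_var)

text \<open>A tuple quantifier becomes \<open>n\<close> element quantifiers. Members of
  \<open>D\<close> equal their own restriction, so nothing is lost by truncating the witness to its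
  first \<open>n\<close> values.\<close>

lemma def_pred_bex_tuple:
  assumes D: "def_tuples \<M> n D"
    and Q: "def_pred \<M> (\<lambda>v. Q (restrict (\<lambda>k. v k) {..<n}) (\<lambda>k. v (n + k)))"
  shows "def_pred \<M> (\<lambda>v. \<exists>z\<in>D. Q z v)"
proof -
  define P where "P = (\<lambda>v. restrict v {..<n} \<in> D \<and> Q (restrict v {..<n}) (\<lambda>k. v (n + k)))"
  have "def_pred \<M> P" unfolding P_def
    using def_pred_and[OF def_pred_tuple_mem[OF D, of "\<lambda>k. k"] Q] by simp
  then have "def_pred \<M> (\<lambda>v. \<exists>z. P (\<lambda>k. if k < n then z k else v (k - n)))"
    by (rule def_pred_ex_many)
  moreover have "(\<exists>z. P (\<lambda>k. if k < n then z k else v (k - n))) = (\<exists>z\<in>D. Q z v)" for v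
  proof -
    have r: "restrict (\<lambda>k. if k < n then z k else v (k - n)) {..<n} = restrict z {..<n}" for z
      by (auto simp: fun_eq_iff restrict_def)
    have "restrict z {..<n} = z" if "z \<in> D" for z
      using that D unfolding def_tuples_def tuples_def
      by (metis PiE_restrict subsetD)
    then have "(\<exists>z. restrict z {..<n} \<in> D \<and> Q (restrict z {..<n}) v) = (\<exists>z\<in>D. Q z v)"
      by metis
    then show ?thesis by (simp add: P_def r)
  qed
  ultimately show ?thesis by simp
qed

lemma def_pred_ball_tuple:
  assumes D: "def_tuples \<M> n D"
    and Q: "def_pred \<M> (\<lambda>v. Q (restrict (\<lambda>k. v k) {..<n}) (\<lambda>k. v (n + k)))"
  shows "def_pred \<M> (\<lambda>v. \<forall>z\<in>D. Q z v)"
  using def_pred_not[OF def_pred_bex_tuple[OF D def_pred_not[OF Q]]] by simp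

lemmas def_intros = def_pred_and def_pred_or def_pred_imp def_pred_not def_pred_ex def_pred_all
  def_pred_less def_pred_eq def_pred_le var_or_const_var var_or_const_const var_or_const_restrict

section \<open>Passage between definable sets and definable predicates\<close>

lemma definable_imp_def_tuples:
  assumes "definable \<M> n D"
  shows "def_tuples \<M> n D"
proof -
  obtain \<phi> c where \<phi>: "wf_formula \<M> \<phi>"
    and D: "D = {x \<in> tuples n. sat \<M> (\<lambda>i. if i < n then x i else c i) \<phi>}"
    using assms unfolding definable_def by blast
  define e where "e = (\<lambda>i. if i < n then Inl i else Inr (c i))"
  have "(\<lambda>i. if i < n then restrict v {..<n} i else c i) = env_val e v" for v
    by (auto simp: fun_eq_iff env_val_def e_def)
  then have "(restrict v {..<n} \<in> D) = sat \<M> (env_val e v) \<phi>" for v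
    by (auto simp: D tuples_def)
  then show ?thesis unfolding def_tuples_def def_pred_def using \<phi> D by blast
qed

lemma def_pred_imp_definable_subset:
  assumes "def_pred \<M> (\<lambda>v. v 0 \<in> A)"
  shows "definable_subset \<M> A"
proof -
  obtain \<phi> e where \<phi>: "wf_formula \<M> \<phi>" and A: "\<And>v. (v 0 \<in> A) = sat \<M> (env_val e v) \<phi>"
    using assms unfolding def_pred_def by blast
  obtain \<phi>' where \<phi>': "wf_formula \<M> \<phi>'"
    "\<And>v a. sat \<M> (\<lambda>i. if i \<in> {i. isl (e i)} then a else v i) \<phi> = sat \<M> (case_nat a v) \<phi>'"
    using formula_identify_vars[OF \<phi>, of "{i. isl (e i)}"] by blast
  define c where "c = (\<lambda>i. projr (e (i - 1)))"
  have "(x 0 \<in> A) = sat \<M> (\<lambda>i. if i < 1 then x i else c i) \<phi>'" for x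
  proof -
    \<comment> \<open>Membership in \<open>A\<close> depends on \<open>v 0\<close> only, so every
      position may be filled with \<open>x 0\<close>. All variables that read a position then share
      one value and can be merged.\<close>
    have "(x 0 \<in> A) = sat \<M> (env_val e (\<lambda>_. x 0)) \<phi>" using A[of "\<lambda>_. x 0"] by simp
    also have "env_val e (\<lambda>_. x 0) = (\<lambda>i. if i \<in> {i. isl (e i)} then x 0 else projr (e i))"
      by (auto simp: fun_eq_iff env_val_def split: sum.splits)
    also have "sat \<M> \<dots> \<phi> = sat \<M> (case_nat (x 0) (\<lambda>i. projr (e i))) \<phi>'" by (rule \<phi>'(2))
    also have "case_nat (x 0) (\<lambda>i. projr (e i)) = (\<lambda>i. if i < 1 then x i else c i)"
      by (auto simp: fun_eq_iff c_def split: nat.splits)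
    finally show ?thesis .
  qed
  then show ?thesis unfolding definable_subset_def definable_def using \<phi>'(1) by blast
qed

section \<open>Thin sets\<close>

text \<open>Orders \<open>L\<close> with \<open>dir L\<close> allow order-dual arguments to be carried out once.\<close>

definition dir :: "('a::linorder \<Rightarrow> 'a \<Rightarrow> bool) \<Rightarrow> bool" where
  "dir L \<longleftrightarrow> L = (<) \<or> L = (>)"

text \<open>Empty interior in first-order form; in a definable family, the indices of thin members
  thus form a definable set.\<close>

definition thin :: "'a::linorder set \<Rightarrow> bool" where
  "thin A \<longleftrightarrow> (\<forall>a b. a < b \<longrightarrow> (\<exists>y. a < y \<and> y < b \<and> y \<notin> A))"

text \<open>A right germ at \<open>x\<close> for \<open>(<)\<close>, a left germ for
  \<open>(>)\<close>; the point \<open>x\<close> itself may lie outside \<open>A\<close>.\<close>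

definition germ_in :: "('a \<Rightarrow> 'a \<Rightarrow> bool) \<Rightarrow> 'a \<Rightarrow> 'a::linorder set \<Rightarrow> bool" where
  "germ_in L x A \<longleftrightarrow> (\<exists>c. L x c \<and> (\<forall>y. L x y \<longrightarrow> L y c \<longrightarrow> y \<in> A))"

lemma dir_less [simp]: "dir (<)" and dir_greater [simp]: "dir (>)"
  by (simp_all add: dir_def)

lemma dir_converse: "dir L \<Longrightarrow> dir (\<lambda>x y. L y x)"
  by (auto simp: dir_def)

lemma dir_trans: "dir L \<Longrightarrow> L x y \<Longrightarrow> L y z \<Longrightarrow> L x z"
  by (auto simp: dir_def)

lemma dir_irrefl: "dir L \<Longrightarrow> \<not> L x x"
  by (auto simp: dir_def)

lemma dir_asym: "dir L \<Longrightarrow> L x y \<Longrightarrow> \<not> L y x"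
  by (auto simp: dir_def)

lemma dir_linear: "dir L \<Longrightarrow> L x y \<or> x = y \<or> L y x"
  by (auto simp: dir_def)

lemma dir_dense:
  fixes x y :: "'a::unbounded_dense_linorder"
  shows "dir L \<Longrightarrow> L x y \<Longrightarrow> \<exists>z. L x z \<and> L z y"
  using dense by (auto simp: dir_def)

lemma dir_unbounded:
  fixes x :: "'a::unbounded_dense_linorder"
  shows "dir L \<Longrightarrow> \<exists>c. L x c"
  using gt_ex lt_ex by (auto simp: dir_def)

lemma dir_between2:
  fixes x :: "'a::unbounded_dense_linorder"
  assumes "dir L" "L x a" "L x b"
  shows "\<exists>c. L x c \<and> L c a \<and> L c b"
  using dir_dense[OF assms(1,2)] dir_dense[OF assms(1,3)] dir_linear[OF assms(1), of a b]
    dir_trans[OF assms(1)] by metis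

lemma thin_dir:
  assumes "dir L" "thin A" "L x c"
  shows "\<exists>y. L x y \<and> L y c \<and> y \<notin> A"
  using assms unfolding dir_def thin_def by auto

lemma thin_subset: "thin B \<Longrightarrow> A \<subseteq> B \<Longrightarrow> thin A"
  unfolding thin_def by blast

lemma thin_singleton: "thin {p::'a::unbounded_dense_linorder}"
  unfolding thin_def
proof (intro allI impI)
  fix a b :: 'a assume "a < b"
  then obtain y where y: "a < y" "y < b" using dense by blast
  obtain z where "a < z" "z < y" using dense[OF y(1)] by blast
  then show "\<exists>y. a < y \<and> y < b \<and> y \<notin> {p}"
    using y by (cases "y = p") (auto intro: less_trans)
qed

lemma germ_in_mono: "germ_in L x A \<Longrightarrow> A \<subseteq> B \<Longrightarrow> germ_in L x B"
  unfolding germ_in_def by blast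

lemma germ_in_not_thin: "dir L \<Longrightarrow> germ_in L x A \<Longrightarrow> \<not> thin A"
  unfolding germ_in_def using thin_dir by metis

lemma germ_in_Int:
  fixes x :: "'a::unbounded_dense_linorder"
  assumes "dir L" "germ_in L x A" "germ_in L x B"
  shows "germ_in L x (A \<inter> B)"
proof -
  obtain c d where c: "L x c" "\<And>y. L x y \<Longrightarrow> L y c \<Longrightarrow> y \<in> A"
    and d: "L x d" "\<And>y. L x y \<Longrightarrow> L y d \<Longrightarrow> y \<in> B"
    using assms unfolding germ_in_def by blast
  obtain e where "L x e" "L e c" "L e d" using dir_between2[OF assms(1) c(1) d(1)] by blast
  then show ?thesis unfolding germ_in_def using c d dir_trans[OF assms(1)] by blast
qed

lemma germ_in_INT:
  fixes x :: "'a::unbounded_dense_linorder"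
  assumes "dir L" "finite I" "\<And>i. i \<in> I \<Longrightarrow> germ_in L x (A i)"
  shows "germ_in L x (\<Inter>i\<in>I. A i)"
  using assms(2,3)
proof (induction I)
  case empty
  then show ?case using dir_unbounded[OF assms(1)] by (auto simp: germ_in_def)
next
  case (insert i I)
  then show ?case using germ_in_Int[OF assms(1)] by simp
qed

lemma germ_in_empty:
  fixes x :: "'a::unbounded_dense_linorder"
  shows "dir L \<Longrightarrow> \<not> germ_in L x {}"
  unfolding germ_in_def using dir_dense by blast

text \<open>If every complement contained a germ, so would the intersection of all of them with the
  union, which is empty.\<close>

lemma germ_in_UN:
  fixes x :: "'a::unbounded_dense_linorder"
  assumes "dir L" "finite I" "\<And>i. i \<in> I \<Longrightarrow> germ_in L x (A i) \<or> germ_in L x (- A i)"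
    and "germ_in L x (\<Union>i\<in>I. A i)"
  shows "\<exists>i\<in>I. germ_in L x (A i)"
proof (rule ccontr)
  assume "\<not> ?thesis"
  then have "germ_in L x (\<Inter>i\<in>I. - A i)"
    using germ_in_INT[OF assms(1,2), of x "\<lambda>i. - A i"] assms(3) by blast
  from germ_in_Int[OF assms(1,4) this] have "germ_in L x {}"
    by (rule germ_in_mono) auto
  then show False using germ_in_empty[OF assms(1)] by blast
qed

lemma germ_in_interval:
  "dir L \<Longrightarrow> a < x \<Longrightarrow> x < b \<Longrightarrow> germ_in L x {a<..<b}"
  unfolding germ_in_def dir_def by (elim disjE) (auto intro: less_trans)

lemma germ_in_interval_cases:
  fixes x :: "'a::unbounded_dense_linorder"
  assumes "dir L"
  shows "germ_in L x {a<..<b} \<or> germ_in L x (- {a<..<b})"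
proof -
  have up: "germ_in (<) x {a<..<b} \<or> germ_in (<) x (- {a<..<b})"
  proof -
    consider "a \<le> x" "x < b" | "x < a" | "b \<le> x" by fastforce
    then show ?thesis
    proof cases
      case 1
      then show ?thesis unfolding germ_in_def by (intro disjI1 exI[of _ b]) auto
    next
      case 2
      then show ?thesis unfolding germ_in_def by (intro disjI2 exI[of _ a]) auto
    next
      case 3
      obtain c where "x < c" using gt_ex by blast
      with 3 show ?thesis unfolding germ_in_def by (intro disjI2 exI[of _ c]) auto
    qed
  qed
  have down: "germ_in (>) x {a<..<b} \<or> germ_in (>) x (- {a<..<b})"
  proof -
    consider "a < x" "x \<le> b" | "b < x" | "x \<le> a" by fastforce
    then show ?thesis
    proof cases
      case 1
      then show ?thesis unfolding germ_in_def by (intro disjI1 exI[of _ a]) auto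
    next
      case 2
      then show ?thesis unfolding germ_in_def by (intro disjI2 exI[of _ b]) auto
    next
      case 3
      obtain c where "c < x" using lt_ex by blast
      with 3 show ?thesis unfolding germ_in_def by (intro disjI2 exI[of _ c]) auto
    qed
  qed
  show ?thesis using assms up down unfolding dir_def by blast
qed

lemma germ_in_singleton_compl:
  fixes x :: "'a::unbounded_dense_linorder"
  assumes "dir L"
  shows "germ_in L x (- {p})"
proof (cases "L x p")
  case True
  then show ?thesis unfolding germ_in_def using dir_irrefl[OF assms] by blast
next
  case False
  then show ?thesis unfolding germ_in_def using dir_unbounded[OF assms] by blast
qed

lemma def_pred_dir:
  assumes "dir L" "var_or_const s" "var_or_const t"
  shows "def_pred \<M> (\<lambda>v. L (s v) (t v))"
  using assms(1) def_pred_less[OF assms(2,3), of \<M>] def_pred_less[OF assms(3,2), of \<M>]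
  unfolding dir_def by auto

section \<open>Definable subsets of the line under completeness and local o-minimality\<close>

locale tame_structure =
  fixes \<M> :: "('a::{unbounded_dense_linorder, linorder_topology}, 'f, 'r) fo_structure"
  assumes complete: "definably_complete \<M>" and lom: "locally_o_minimal \<M>"
begin

abbreviation def_set :: "'a set \<Rightarrow> bool" where
  "def_set A \<equiv> def_pred \<M> (\<lambda>v. v 0 \<in> A)"

abbreviation def_rel :: "('a \<Rightarrow> 'a \<Rightarrow> bool) \<Rightarrow> bool" where
  "def_rel R \<equiv> def_pred \<M> (\<lambda>v. R (v 0) (v (Suc 0)))"

text \<open>Near \<open>x\<close> the set is a finite union of points and intervals, and each of
  these, or its complement, contains a germ. Germs in finitely many complements intersect in a germ
  that avoids the union.\<close>

lemma germ_dichotomy: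
  assumes "def_set A" "dir L"
  shows "germ_in L x A \<or> germ_in L x (- A)"
proof -
  obtain I \<C> where I: "open_interval I" "x \<in> I" and \<C>: "finite \<C>"
    "\<forall>C\<in>\<C>. (\<exists>p. C = {p}) \<or> open_interval C" "A \<inter> I = \<Union>\<C>"
    using lom[unfolded locally_o_minimal_def, rule_format,
        OF def_pred_imp_definable_subset[OF assms(1)], of x] by metis
  have gI: "germ_in L x I" using I germ_in_interval[OF assms(2)] unfolding open_interval_def by auto
  have gC: "germ_in L x C \<or> germ_in L x (- C)" if "C \<in> \<C>" for C
    using \<C>(2) that germ_in_singleton_compl[OF assms(2)] germ_in_interval_cases[OF assms(2)]
    unfolding open_interval_def by metis
  show ?thesis
  proof (cases "\<exists>C\<in>\<C>. germ_in L x C")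
    case True
    then show ?thesis using \<C>(3) germ_in_mono by blast
  next
    case False
    then have "germ_in L x (\<Inter>C\<in>\<C>. - C)" using gC germ_in_INT[OF assms(2) \<C>(1)] by blast
    from germ_in_Int[OF assms(2) gI this] have "germ_in L x (- A)"
      by (rule germ_in_mono) (use \<C>(3) in auto)
    then show ?thesis by blast
  qed
qed

text \<open>Completeness yields a bound in the extended line; \<open>x\<close> on one side and
  \<open>y\<close> on the other make it finite. For \<open>(>)\<close> the bound is a
  supremum.\<close>

lemma infimum_exists:
  assumes "def_set X" "dir L" "y \<in> X" "\<And>z. z \<in> X \<Longrightarrow> L x z"
  obtains m where "m = x \<or> L x m" "\<And>z. z \<in> X \<Longrightarrow> m = z \<or> L m z"
    "\<And>c. L m c \<Longrightarrow> \<exists>z\<in>X. L z c"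
proof -
  have bounds: "\<exists>s. isLub UNIV (Fin ` X) s" "\<exists>s. isGlb UNIV (Fin ` X) s"
    using complete def_pred_imp_definable_subset[OF assms(1)] unfolding definably_complete_def
    by blast+
  consider "L = (<)" | "L = (>)" using assms(2) unfolding dir_def by blast
  then show ?thesis
  proof cases
    case 1
    obtain s where s: "isGlb UNIV (Fin ` X) s" using bounds by blast
    have lb: "s \<le> Fin z" if "z \<in> X" for z
      using s that by (auto simp: isGlb_def greatestP_def isLb_def setge_def)
    have gr: "t \<le> s" if "\<And>z. z \<in> X \<Longrightarrow> t \<le> Fin z" for t
      using s that by (auto simp: isGlb_def greatestP_def isLb_def setge_def setle_def)
    have "Fin x \<le> s" using gr assms(4) 1 by (simp add: less_imp_le)
    moreover have "s \<le> Fin y" using lb assms(3) by blast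
    ultimately obtain m where m: "s = Fin m" by (cases s) auto
    show ?thesis
    proof (rule that)
      show "m = x \<or> L x m" using \<open>Fin x \<le> s\<close> m 1 by auto
      show "m = z \<or> L m z" if "z \<in> X" for z using lb[OF that] m 1 by auto
      show "\<exists>z\<in>X. L z c" if "L m c" for c
      proof (rule ccontr)
        assume "\<not> ?thesis"
        then have "c \<le> z" if "z \<in> X" for z using that 1 by (auto simp: not_less)
        then show False using gr[of "Fin c"] m 1 that by auto
      qed
    qed
  next
    case 2
    obtain s where s: "isLub UNIV (Fin ` X) s" using bounds by blast
    have ub: "Fin z \<le> s" if "z \<in> X" for z
      using s that by (auto simp: isLub_def leastP_def isUb_def setle_def)
    have ls: "s \<le> t" if "\<And>z. z \<in> X \<Longrightarrow> Fin z \<le> t" for t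
      using s that by (auto simp: isLub_def leastP_def isUb_def setge_def setle_def)
    have "s \<le> Fin x" using ls assms(4) 2 by (simp add: less_imp_le)
    moreover have "Fin y \<le> s" using ub assms(3) by blast
    ultimately obtain m where m: "s = Fin m" by (cases s) auto
    show ?thesis
    proof (rule that)
      show "m = x \<or> L x m" using \<open>s \<le> Fin x\<close> m 2 by auto
      show "m = z \<or> L m z" if "z \<in> X" for z using ub[OF that] m 2 by auto
      show "\<exists>z\<in>X. L z c" if "L m c" for c
      proof (rule ccontr)
        assume "\<not> ?thesis"
        then have "z \<le> c" if "z \<in> X" for z using that 2 by (auto simp: not_less)
        then show False using ls[of "Fin c"] m 2 that by auto
      qed
    qed
  qed
qed

text \<open>The infimum is attained: just beyond the infimum \<open>m\<close> lies a germ that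
  avoids \<open>A\<close>, yet elements of \<open>A\<close> come arbitrarily close to
  \<open>m\<close>, so \<open>m\<close> is one of them.\<close>

lemma thin_least:
  assumes A: "def_set A" and "thin A" and L: "dir L" and "y \<in> A" "L x y"
  obtains m where "m \<in> A" "L x m" "\<And>z. z \<in> A \<Longrightarrow> L x z \<Longrightarrow> m = z \<or> L m z"
proof -
  have d: "def_set {z \<in> A. L x z}" unfolding mem_Collect_eq
    by (intro def_intros def_pred_mem[OF A] def_pred_dir[OF L])
  have y: "y \<in> {z \<in> A. L x z}" and gt: "\<And>z. z \<in> {z \<in> A. L x z} \<Longrightarrow> L x z"
    using assms by auto
  obtain m where m: "m = x \<or> L x m"
    "\<And>z. z \<in> {z \<in> A. L x z} \<Longrightarrow> m = z \<or> L m z"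
    "\<And>c. L m c \<Longrightarrow> \<exists>z\<in>{z \<in> A. L x z}. L z c"
    using infimum_exists[OF d L y gt] by (metis (no_types, lifting))
  have "germ_in L m (- A)" using germ_dichotomy[OF A L] germ_in_not_thin[OF L] \<open>thin A\<close> by blast
  then obtain c where c: "L m c" "\<And>z. L m z \<Longrightarrow> L z c \<Longrightarrow> z \<notin> A" unfolding germ_in_def by auto
  obtain z where z: "z \<in> A" "L x z" "L z c" using m(3)[OF c(1)] by auto
  then have "m = z" using m(2) c(2) by blast
  then show ?thesis using that[of m] m(2) z by blast
qed

section \<open>Unions of definable families of thin sets\<close>

lemma thin_UN:
  assumes "finite I" "\<And>i. i \<in> I \<Longrightarrow> def_set (A i)" "\<And>i. i \<in> I \<Longrightarrow> thin (A i)"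
  shows "thin (\<Union>i\<in>I. A i)"
proof (rule ccontr)
  assume "\<not> thin (\<Union>i\<in>I. A i)"
  then obtain a b where ab: "a < b" "\<And>y. a < y \<Longrightarrow> y < b \<Longrightarrow> y \<in> (\<Union>i\<in>I. A i)"
    unfolding thin_def by blast
  obtain x where x: "a < x" "x < b" using dense[OF ab(1)] by blast
  have "germ_in (<) x (\<Union>i\<in>I. A i)"
    by (rule germ_in_mono[OF germ_in_interval[OF dir_less x]]) (use ab in auto)
  then obtain i where "i \<in> I" "germ_in (<) x (A i)"
    using germ_in_UN[OF dir_less assms(1), of x A] germ_dichotomy[OF assms(2) dir_less] by blast
  then show False using assms(3) germ_in_not_thin[OF dir_less] by blast
qed

lemma thin_Un:
  assumes "def_set A" "def_set B" "thin A" "thin B"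
  shows "thin (A \<union> B)"
proof -
  have "thin (\<Union>i\<in>{True, False}. if i then A else B)"
    by (rule thin_UN) (use assms in \<open>auto split: if_splits\<close>)
  then show ?thesis by (simp add: Un_commute)
qed

text \<open>Each point close to \<open>x\<close> is the first point after \<open>x\<close> of some member of the family:
  the set of these first points accumulates at \<open>x\<close>, so it contains a germ at \<open>x\<close>.\<close>

lemma first_points:
  assumes R: "def_rel R" and thin: "\<And>t. thin {y. R t y}" and L: "dir L"
    and x: "germ_in L x {y. \<exists>t. R t y}"
  obtains c where "L x c"
    "\<And>y. L x y \<Longrightarrow> L y c \<Longrightarrow> \<exists>t. R t y \<and> (\<forall>z. L x z \<longrightarrow> L z y \<longrightarrow> \<not> R t z)"
proof -
  define F where "F = {y. \<exists>t. R t y \<and> (\<forall>z. L x z \<longrightarrow> L z y \<longrightarrow> \<not> R t z)}"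
  have F: "def_set F" unfolding F_def mem_Collect_eq
    by (intro def_intros def_pred_binary[OF R] def_pred_dir[OF L])
  have "\<not> germ_in L x (- F)"
  proof
    assume "germ_in L x (- F)"
    from germ_in_Int[OF L this x] obtain c where c: "L x c"
      "\<And>y. L x y \<Longrightarrow> L y c \<Longrightarrow> y \<notin> F \<and> (\<exists>t. R t y)" unfolding germ_in_def by auto
    obtain y where y: "L x y" "L y c" using dir_dense[OF L c(1)] by blast
    then obtain t where t: "R t y" using c(2) by blast
    \<comment> \<open>The first point \<open>m\<close> of the member \<open>t\<close> after
      \<open>x\<close> comes no later than \<open>y\<close>, so it is a point of \<open>F\<close>
      before \<open>c\<close>.\<close>
    have "def_set {y. R t y}" unfolding mem_Collect_eq by (intro def_intros def_pred_binary[OF R])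
    then obtain m where m: "R t m" "L x m" "\<And>z. R t z \<Longrightarrow> L x z \<Longrightarrow> m = z \<or> L m z"
      using thin_least[OF _ thin[of t] L, of y x] t y(1) by auto
    have "m \<in> F" unfolding F_def using m dir_asym[OF L] dir_irrefl[OF L] by blast
    moreover have "L m c" using m(3)[OF t y(1)] y(2) dir_trans[OF L] by blast
    ultimately show False using c(2) m(2) by blast
  qed
  then have "germ_in L x F" using germ_dichotomy[OF F L] by blast
  then show ?thesis using that unfolding germ_in_def F_def by blast
qed

lemma not_thin_germ:
  fixes A :: "'a set"
  assumes "\<not> thin A" "dir L"
  obtains x where "germ_in L x A"
proof -
  obtain a b where ab: "a < b" "\<And>y. a < y \<Longrightarrow> y < b \<Longrightarrow> y \<in> A"
    using assms(1) unfolding thin_def by blast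
  obtain x where x: "a < x" "x < b" using dense[OF ab(1)] by blast
  have "germ_in L x A"
    by (rule germ_in_mono[OF germ_in_interval[OF assms(2) x]]) (use ab in auto)
  then show ?thesis using that by blast
qed

text \<open>Suppose the union fills a germ at \<open>x\<close>, and let the member \<open>t\<close>
  contain a point \<open>y\<close> close to \<open>x\<close>. A later \<open>z\<close> is the first
  point of some member \<open>s\<close>, which therefore misses \<open>y\<close>. Comparability puts
  the member \<open>s\<close> inside the member \<open>t\<close>, so the latter contains a whole
  interval after \<open>y\<close>.\<close>

lemma thin_chain_union:
  assumes R: "def_rel R" and thin: "\<And>t. thin {y. R t y}"
    and chain: "\<And>s t. {y. R s y} \<subseteq> {y. R t y} \<or> {y. R t y} \<subseteq> {y. R s y}"
  shows "thin {y. \<exists>t. R t y}"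
proof (rule ccontr)
  assume "\<not> ?thesis"
  then obtain x where "germ_in (<) x {y. \<exists>t. R t y}" using not_thin_germ dir_less by blast
  then obtain c where c: "x < c"
    "\<And>y. x < y \<Longrightarrow> y < c \<Longrightarrow> \<exists>t. R t y \<and> (\<forall>z. x < z \<longrightarrow> z < y \<longrightarrow> \<not> R t z)"
    using first_points[OF R thin dir_less] by metis
  obtain y where y: "x < y" "y < c" using dense[OF c(1)] by blast
  then obtain t where t: "R t y" using c(2) by blast
  have "R t z" if z: "y < z" "z < c" for z
  proof -
    obtain s where "R s z" "\<not> R s y" using c(2)[of z] z y by (meson less_trans)
    then show ?thesis using chain[of s t] t by blast
  qed
  then show False using thin[of t] y(2) unfolding thin_def by blast
qed

text \<open>Induction along the indices beyond \<open>p\<close>. The set \<open>G e\<close> is the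
  union of the members with indices up to \<open>e\<close>. A least index with a non-thin
  \<open>G m\<close> is either the first index or has an immediate predecessor, and adding one thin
  member preserves thinness. The sets \<open>G e\<close> form a chain, so
  \<open>thin_chain_union\<close> applies to them.\<close>

lemma thin_family_union_beyond:
  assumes E: "def_set E" "thin E" and Q: "def_rel Q" and thin: "\<And>e. e \<in> E \<Longrightarrow> thin {y. Q e y}"
    and L: "dir L"
  shows "thin {y. \<exists>e\<in>E. L p e \<and> Q e y}"
proof -
  note defs = def_intros def_pred_mem[OF E(1)] def_pred_binary[OF Q] def_pred_dir[OF L]
  define G where "G = (\<lambda>e. {y. \<exists>e'. e' \<in> E \<and> L p e' \<and> (e' = e \<or> L e' e) \<and> Q e' y})"
  have G: "thin (G e)" if e: "e \<in> E" "L p e" for e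
  proof (rule ccontr)
    assume bad: "\<not> thin (G e)"
    define B where "B = {e. e \<in> E \<and> L p e \<and> \<not> thin (G e)}"
    have "def_set B" unfolding B_def thin_def G_def mem_Collect_eq by (intro defs)
    moreover have "thin B" by (rule thin_subset[OF E(2)]) (auto simp: B_def)
    moreover have "e \<in> B" using e bad by (simp add: B_def)
    moreover have "L p z" if "z \<in> B" for z using that by (simp add: B_def)
    ultimately obtain m where m: "m \<in> B" "\<And>z. z \<in> B \<Longrightarrow> m = z \<or> L m z"
      using thin_least[OF _ _ L, of B e p] by metis
    then have mE: "m \<in> E" "L p m" "\<not> thin (G m)" by (auto simp: B_def)
    have dE: "def_set {e. e \<in> E \<and> L p e}" unfolding mem_Collect_eq by (intro defs)
    have tE: "thin {e. e \<in> E \<and> L p e}" by (rule thin_subset[OF E(2)]) auto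
    show False
    proof (cases "\<exists>e. e \<in> E \<and> L p e \<and> L e m")
      case False
      then have "G m \<subseteq> {y. Q m y}" unfolding G_def by auto
      then show False using thin_subset[OF thin] mE by blast
    next
      case True
      then obtain e where e: "e \<in> {e. e \<in> E \<and> L p e}" "L e m" by blast
      \<comment> \<open>In the reversed direction, \<open>thin_least\<close> yields the immediate
        predecessor of \<open>m\<close> among the indices.\<close>
      obtain m' where "m' \<in> {e. e \<in> E \<and> L p e}" and m'm: "L m' m"
        and max: "\<And>z. z \<in> {e. e \<in> E \<and> L p e} \<Longrightarrow> L z m \<Longrightarrow> m' = z \<or> L z m'"
        by (rule thin_least[OF dE tE dir_converse[OF L] e]) (rule that)
      then have m': "m' \<in> E" "L p m'" by auto
      have "thin (G m')"
      proof (rule ccontr)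
        assume "\<not> thin (G m')"
        then have "m' \<in> B" using m' by (simp add: B_def)
        then show False using m(2) m'm dir_asym[OF L] dir_irrefl[OF L] by blast
      qed
      moreover have "def_set (G m')" unfolding G_def mem_Collect_eq by (intro defs)
      moreover have "def_set {y. Q m y}" unfolding mem_Collect_eq by (intro defs)
      ultimately have "thin (G m' \<union> {y. Q m y})" using thin_Un thin mE(1) by blast
      moreover have "G m \<subseteq> G m' \<union> {y. Q m y}" unfolding G_def using max by blast
      ultimately show False using thin_subset mE(3) by blast
    qed
  qed
  \<comment> \<open>The chain lemma runs over all points of the line, so the empty set is assigned
    to those that are not indices beyond \<open>p\<close>.\<close>
  define R where "R = (\<lambda>t y. t \<in> E \<and> L p t \<and> y \<in> G t)"
  have "def_rel R" unfolding R_def G_def mem_Collect_eq by (intro defs)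
  moreover have "thin {y. R t y}" for t
    using G[of t] thin_subset[OF thin_singleton, of "{y. R t y}"] by (cases "t \<in> E \<and> L p t") (auto simp: R_def)
  moreover have "{y. R s y} \<subseteq> {y. R t y} \<or> {y. R t y} \<subseteq> {y. R s y}" for s t
    using dir_linear[OF L, of s t] dir_trans[OF L] unfolding R_def G_def by blast
  ultimately have "thin {y. \<exists>t. R t y}" by (rule thin_chain_union)
  moreover have "{y. \<exists>e\<in>E. L p e \<and> Q e y} \<subseteq> {y. \<exists>t. R t y}" unfolding R_def G_def by blast
  ultimately show ?thesis using thin_subset by blast
qed

text \<open>The induction needs a starting point, so \<open>E\<close> is cut at an arbitrary
  \<open>p\<close>; the indices above, below and at \<open>p\<close> are treated separately.\<close>

lemma thin_family_union:
  assumes E: "def_set E" "thin E" and Q: "def_rel Q" and thin: "\<And>e. e \<in> E \<Longrightarrow> thin {y. Q e y}"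
  shows "thin {y. \<exists>e. e \<in> E \<and> Q e y}"
proof -
  obtain p :: 'a where True by blast
  define F where "F = (\<lambda>i::nat. {y. \<exists>e. e \<in> E \<and>
    (if i = 0 then p < e else if i = 1 then e < p else e = p) \<and> Q e y})"
  note defs = def_intros def_pred_mem[OF E(1)] def_pred_binary[OF Q]
  have d: "def_set (F i)" for i
    unfolding F_def mem_Collect_eq by (cases "i = 0"; cases "i = 1"; simp; intro defs)
  have "thin (F 0)" using thin_family_union_beyond[OF assms dir_less, of p]
    by (rule thin_subset) (auto simp: F_def)
  moreover have "thin (F 1)" using thin_family_union_beyond[OF assms dir_greater, of p]
    by (rule thin_subset) (auto simp: F_def)
  moreover have "thin (F 2)"
  proof (cases "p \<in> E")
    case True
    show ?thesis by (rule thin_subset[OF thin[OF True]]) (auto simp: F_def)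
  next
    case False
    show ?thesis by (rule thin_subset[OF thin_singleton]) (use False in \<open>auto simp: F_def\<close>)
  qed
  ultimately have "thin (\<Union>i\<in>{0,1,2}. F i)" using d by (intro thin_UN) auto
  moreover have "{y. \<exists>e. e \<in> E \<and> Q e y} \<subseteq> (\<Union>i\<in>{0,1,2}. F i)"
  proof
    fix y assume "y \<in> {y. \<exists>e. e \<in> E \<and> Q e y}"
    then obtain e where e: "e \<in> E" "Q e y" by blast
    consider "p < e" | "e < p" | "e = p" by fastforce
    then have "y \<in> F 0 \<or> y \<in> F 1 \<or> y \<in> F 2"
      using e by cases (auto simp: F_def)
    then show "y \<in> (\<Union>i\<in>{0,1,2}. F i)" by simp
  qed
  ultimately show ?thesis by (rule thin_subset)
qed

text \<open>For fixed \<open>y\<close>, the parameters \<open>w\<close> with \<open>Y w y\<close>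
  form an initial segment of what lies beyond \<open>y\<close>. Take \<open>y0\<close> close to
  \<open>x\<close> and then \<open>w'\<close> shortly beyond \<open>y0\<close> with
  \<open>Y w' y0\<close>. Any \<open>y\<close> between them is the first point of some member
  \<open>t\<close> that misses \<open>y0\<close>; such a \<open>t\<close> lies beyond
  \<open>w'\<close>, whence \<open>Y w' y\<close>. So one member would fill the interval from
  \<open>y0\<close> to \<open>w'\<close>.\<close>

lemma thin_interval_family_union:
  assumes Y: "def_rel Y" and thin: "\<And>w. thin {y. Y w y}" and L: "dir L"
    and beyond: "\<And>w y. Y w y \<Longrightarrow> L y w"
    and down: "\<And>w w' y. Y w y \<Longrightarrow> L y w' \<Longrightarrow> L w' w \<Longrightarrow> Y w' y"
  shows "thin {y. \<exists>w. Y w y}"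
proof (rule ccontr)
  assume "\<not> ?thesis"
  then obtain x where "germ_in L x {y. \<exists>w. Y w y}" using not_thin_germ[OF _ L] by blast
  then obtain c where c: "L x c"
    "\<And>y. L x y \<Longrightarrow> L y c \<Longrightarrow> \<exists>t. Y t y \<and> (\<forall>z. L x z \<longrightarrow> L z y \<longrightarrow> \<not> Y t z)"
    using first_points[OF Y thin L] by metis
  obtain y0 where y0: "L x y0" "L y0 c" using dir_dense[OF L c(1)] by blast
  then obtain w where w: "Y w y0" using c(2) by blast
  obtain w' where w': "L y0 w'" "L w' w" "L w' c"
    using dir_between2[OF L beyond[OF w] y0(2)] by blast
  have Yw': "Y w' y0" using down w w' by blast
  have "Y w' y" if y: "L y0 y" "L y w'" for y
  proof -
    obtain t where t: "Y t y" "\<not> Y t y0"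
      using c(2)[of y] y y0(1) w'(3) dir_trans[OF L] by meson
    have "L y0 t" using beyond[OF t(1)] y(1) dir_trans[OF L] by blast
    \<comment> \<open>Otherwise \<open>Y w' y0\<close> would pass down to \<open>t\<close>, contrary
      to the choice of \<open>t\<close>.\<close>
    then have "t \<noteq> w'" "\<not> L t w'" using t(2) Yw' down by blast+
    then have "L w' t" using dir_linear[OF L] by blast
    then show ?thesis using down t(1) y(2) by blast
  qed
  then show False using thin_dir[OF L thin w'(1), of w'] by blast
qed

text \<open>\<open>G\<close> is the graph of a partial function, and \<open>w\<close> separates its
  value at \<open>x\<close> from its values just to the right of \<open>x\<close>. The direction
  \<open>L\<close> concerns values only; in the domain the jump is always on the right. The sets
  \<open>Y w\<close> are the images of the jump sets.\<close>

lemma no_jump_function: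
  assumes G: "def_rel G" and L: "dir L" and ab: "a < b"
    and func: "\<And>x y y'. G x y \<Longrightarrow> G x y' \<Longrightarrow> y = y'"
    and jump: "\<And>x. a < x \<Longrightarrow> x < b \<Longrightarrow> \<exists>y w. G x y \<and> L y w \<and>
      (\<exists>u. x < u \<and> (\<forall>x' y'. x < x' \<longrightarrow> x' < u \<longrightarrow> G x' y' \<longrightarrow> \<not> L y' w))"
  shows False
proof -
  note defs = def_intros def_pred_binary[OF G] def_pred_dir[OF L]
  define J where "J = (\<lambda>w x y. a < x \<and> x < b \<and> G x y \<and> L y w \<and>
    (\<exists>u. x < u \<and> (\<forall>x' y'. x < x' \<longrightarrow> x' < u \<longrightarrow> G x' y' \<longrightarrow> \<not> L y' w)))"
  define Y where "Y = (\<lambda>w y. \<exists>x. J w x y)"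
  \<comment> \<open>Inside an interval of jumps across \<open>w\<close>, a point \<open>x'\<close>
    shortly after \<open>x\<close> has a value before \<open>w\<close>, which the jump at
    \<open>x\<close> forbids.\<close>
  have thinJ: "thin {x. \<exists>y. J w x y}" for w
  proof (rule ccontr)
    assume "\<not> ?thesis"
    then obtain c d where cd: "c < d" "\<And>x. c < x \<Longrightarrow> x < d \<Longrightarrow> \<exists>y. J w x y"
      unfolding thin_def by auto
    obtain x where x: "c < x" "x < d" using dense[OF cd(1)] by blast
    then obtain u where u: "x < u" "\<And>x' y'. x < x' \<Longrightarrow> x' < u \<Longrightarrow> G x' y' \<Longrightarrow> \<not> L y' w"
      using cd(2) unfolding J_def by blast
    obtain x' where x': "x < x'" "x' < u" "x' < d"
      using dir_between2[OF dir_less u(1) x(2)] by blast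
    then obtain y' where "J w x' y'" using cd(2)[of x'] x(1) less_trans by blast
    then show False using u(2)[OF x'(1,2)] unfolding J_def by blast
  qed
  have thinY: "thin {y. Y w y}" for w
  proof -
    have "thin {y. \<exists>x. x \<in> {x. \<exists>y. J w x y} \<and> J w x y}"
    proof (rule thin_family_union[OF _ thinJ])
      show "def_set {x. \<exists>y. J w x y}" unfolding J_def mem_Collect_eq by (intro defs)
      show "def_rel (J w)" unfolding J_def by (intro defs)
      show "thin {y. J w x y}" if x: "x \<in> {x. \<exists>y. J w x y}" for x
      proof -
        obtain y where "J w x y" using x by blast
        then show ?thesis using func
          by (intro thin_subset[OF thin_singleton[of y]]) (auto simp: J_def)
      qed
    qed
    then show ?thesis by (rule thin_subset) (auto simp: Y_def)
  qed
  \<comment> \<open>A jump across \<open>w\<close> is also a jump across every \<open>w'\<close>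
    between the value and \<open>w\<close>; this is the downward closure of the family
    \<open>Y\<close>.\<close>
  have thinYall: "thin {y. \<exists>w. Y w y}"
  proof (rule thin_interval_family_union[OF _ thinY L])
    show "def_rel Y" unfolding Y_def J_def by (intro defs)
    show "L y w" if "Y w y" for w y using that unfolding Y_def J_def by blast
    show "Y w' y" if "Y w y" "L y w'" "L w' w" for w w' y
      using that dir_trans[OF L] unfolding Y_def J_def by blast
  qed
  \<comment> \<open>The fibres over the thin set of values have thin union. A fibre containing an
    interval would make the function constant there and exclude jumps.\<close>
  have "thin {x. \<exists>y. y \<in> {y. \<exists>w. Y w y} \<and> (a < x \<and> x < b \<and> G x y)}"
  proof (rule thin_family_union[OF _ thinYall])
    show "def_set {y. \<exists>w. Y w y}" unfolding Y_def J_def mem_Collect_eq by (intro defs)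
    show "def_rel (\<lambda>y x. a < x \<and> x < b \<and> G x y)" by (intro defs)
    show "thin {x. a < x \<and> x < b \<and> G x y}" for y
    proof (rule ccontr)
      assume "\<not> ?thesis"
      then obtain c d where cd: "c < d" "\<And>x. c < x \<Longrightarrow> x < d \<Longrightarrow> a < x \<and> x < b \<and> G x y"
        unfolding thin_def by auto
      obtain x where x: "c < x" "x < d" using dense[OF cd(1)] by blast
      then obtain w u where u: "L y w" "x < u"
          "\<And>x' y'. x < x' \<Longrightarrow> x' < u \<Longrightarrow> G x' y' \<Longrightarrow> \<not> L y' w"
        using jump[of x] cd(2)[OF x] func by metis
      obtain x' where x': "x < x'" "x' < u" "x' < d"
        using dir_between2[OF dir_less u(2) x(2)] by blast
      then have "G x' y" using cd(2)[of x'] x(1) by auto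
      then show False using u(3)[OF x'(1,2)] u(1) by blast
    qed
  qed
  then obtain x where x: "a < x" "x < b" "\<not> (\<exists>y w. Y w y \<and> G x y)"
    using ab unfolding thin_def by blast
  then show False using jump[OF x(1,2)] unfolding Y_def J_def by blast
qed

end

section \<open>Discrete sets of tuples\<close>

text \<open>Discreteness through open boxes: leaving an isolating box violates one of finitely many
  inequalities, two per coordinate.\<close>

definition box_isolated :: "nat \<Rightarrow> (nat \<Rightarrow> 'a::linorder) set \<Rightarrow> bool" where
  "box_isolated n D \<longleftrightarrow> (\<forall>z\<in>D. \<exists>l u. (\<forall>k<n. l k < z k \<and> z k < u k) \<and>
     (\<forall>z'\<in>D. (\<forall>k<n. l k < z' k \<and> z' k < u k) \<longrightarrow> z' = z))"

lemma box_isolated_subset: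
  assumes "box_isolated n D" "D' \<subseteq> D"
  shows "box_isolated n D'"
  unfolding box_isolated_def
proof
  fix z assume "z \<in> D'"
  then obtain l u where "\<forall>k<n. l k < z k \<and> z k < u k"
    "\<forall>z'\<in>D. (\<forall>k<n. l k < z' k \<and> z' k < u k) \<longrightarrow> z' = z"
    using assms unfolding box_isolated_def by (metis subsetD)
  then show "\<exists>l u. (\<forall>k<n. l k < z k \<and> z k < u k) \<and>
      (\<forall>z'\<in>D'. (\<forall>k<n. l k < z' k \<and> z' k < u k) \<longrightarrow> z' = z)"
    using assms(2) by (intro exI[of _ l] exI[of _ u]) auto
qed

lemma topspace_tuple_topology: "topspace (tuple_topology n) = tuples n"
  by (simp add: tuple_topology_def tuples_def)

lemma open_contains_interval:
  fixes S :: "'a::{unbounded_dense_linorder, linorder_topology} set"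
  assumes "open S" "x \<in> S"
  shows "\<exists>l u. l < x \<and> x < u \<and> {l<..<u} \<subseteq> S"
proof -
  obtain a b where "a < x" "x < b" using lt_ex gt_ex by blast
  obtain l where l: "l < x" "{l<..x} \<subseteq> S" using open_left[OF assms \<open>a < x\<close>] by blast
  obtain u where u: "x < u" "{x..<u} \<subseteq> S" using open_right[OF assms \<open>x < b\<close>] by blast
  have "{l<..<u} \<subseteq> {l<..x} \<union> {x..<u}" by auto
  then show ?thesis using l u by blast
qed

lemma discrete_imp_box_isolated:
  fixes D :: "(nat \<Rightarrow> 'a::{unbounded_dense_linorder, linorder_topology}) set"
  assumes D: "D \<subseteq> tuples n" and disc: "discrete_subset n D"
  shows "box_isolated n D"
  unfolding box_isolated_def
proof
  fix z assume z: "z \<in> D"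
  have "openin (subtopology (tuple_topology n) D) {z}"
    using disc z unfolding discrete_subset_def by simp
  then obtain T where T: "openin (tuple_topology n) T" "{z} = T \<inter> D"
    unfolding openin_subtopology by blast
  have "z \<in> T" using T(2) by blast
  from bspec[OF T(1)[unfolded tuple_topology_def openin_product_topology_alt] this]
  obtain U where U: "\<forall>k\<in>{..<n}. openin euclidean (U k)" "z \<in> Pi\<^sub>E {..<n} U"
    "Pi\<^sub>E {..<n} U \<subseteq> T"
    by (elim exE conjE)
  have "\<exists>l u. l < z k \<and> z k < u \<and> {l<..<u} \<subseteq> U k" if "k < n" for k
    by (rule open_contains_interval) (use U that in \<open>auto simp: PiE_iff\<close>)
  then obtain l u where lu: "\<And>k. k < n \<Longrightarrow> l k < z k \<and> z k < u k \<and> {l k<..<u k} \<subseteq> U k"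
    by metis
  have "z' = z" if z': "z' \<in> D" "\<forall>k<n. l k < z' k \<and> z' k < u k" for z'
  proof -
    have "z' \<in> extensional {..<n}" using z'(1) D by (auto simp: tuples_def PiE_iff)
    then have "z' \<in> Pi\<^sub>E {..<n} U" using z'(2) lu by (force simp: PiE_iff)
    then show ?thesis using U(3) T(2) z'(1) by blast
  qed
  then show "\<exists>l u. (\<forall>k<n. l k < z k \<and> z k < u k) \<and>
      (\<forall>z'\<in>D. (\<forall>k<n. l k < z' k \<and> z' k < u k) \<longrightarrow> z' = z)"
    using lu by blast
qed

lemma box_isolated_imp_discrete:
  fixes D :: "(nat \<Rightarrow> 'a::{unbounded_dense_linorder, linorder_topology}) set"
  assumes D: "D \<subseteq> tuples n" and iso: "box_isolated n D"
  shows "discrete_subset n D"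
proof -
  have "openin (subtopology (tuple_topology n) D) {z}" if z: "z \<in> D" for z
  proof -
    obtain l u where lu: "\<forall>k<n. l k < z k \<and> z k < u k"
      "\<forall>z'\<in>D. (\<forall>k<n. l k < z' k \<and> z' k < u k) \<longrightarrow> z' = z"
      using bspec[OF iso[unfolded box_isolated_def] z] by (elim exE conjE)
    define T where "T = (\<Pi>\<^sub>E k\<in>{..<n}. {l k<..<u k})"
    have "openin (tuple_topology n) T" unfolding tuple_topology_def T_def
      by (subst openin_PiE) auto
    moreover have "z \<in> T" using lu(1) z D by (auto simp: T_def tuples_def PiE_iff)
    moreover have "z' = z" if "z' \<in> T" "z' \<in> D" for z'
      using lu(2)[rule_format, OF that(2)] that(1) by (auto simp: T_def PiE_iff)
    ultimately have "openin (tuple_topology n) T" "{z} = T \<inter> D" using z by blast+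
    then show ?thesis unfolding openin_subtopology by blast
  qed
  moreover have "topspace (subtopology (tuple_topology n) D) = D"
    using D by (auto simp: topspace_tuple_topology)
  ultimately show ?thesis unfolding discrete_subset_def
    by (subst eq_commute) (simp only: discrete_topology_unique, blast)
qed

section \<open>Projections of definable discrete sets to one coordinate\<close>

context tame_structure
begin

text \<open>Definable choice with parameter \<open>p\<close>: the least element from
  \<open>p\<close> on or, if there is none, the greatest element. Both come from
  \<open>thin_least\<close>.\<close>

lemma thin_canonical_element:
  assumes "def_set A" "thin A" "y \<in> A"
  shows "\<exists>y\<in>A. (p \<le> y \<and> (\<forall>z\<in>A. p \<le> z \<longrightarrow> y \<le> z)) \<or> (y < p \<and> (\<forall>z\<in>A. z \<le> y))"
proof -
  consider "p \<in> A" | "p \<notin> A" "\<exists>y\<in>A. p < y" | "p \<notin> A" "\<forall>z\<in>A. z < p"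
    by (metis linorder_neqE)
  then show ?thesis
  proof cases
    case 1
    then show ?thesis by blast
  next
    case 2
    then obtain y where y: "y \<in> A" "p < y" by blast
    obtain m where "m \<in> A" "p < m" "\<And>z. z \<in> A \<Longrightarrow> p < z \<Longrightarrow> m = z \<or> m < z"
      by (rule thin_least[OF assms(1,2) dir_less y]) (rule that)
    then show ?thesis using 2(1) by (metis le_less)
  next
    case 3
    then have "p > y" using assms(3) by blast
    obtain m where "m \<in> A" "p > m" "\<And>z. z \<in> A \<Longrightarrow> p > z \<Longrightarrow> m = z \<or> m > z"
      by (rule thin_least[OF assms(1,2) dir_greater assms(3) \<open>p > y\<close>]) (rule that)
    then show ?thesis using 3(2) by (metis le_less)
  qed
qed

text \<open>The coordinates become functions of coordinate \<open>i\<close> one after another: in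
  each fibre only the tuples whose next coordinate is the canonical element survive.\<close>

lemma definable_section_upto:
  assumes D: "def_tuples \<M> n D" and i: "i < n"
    and thin: "\<And>x k. k < n \<Longrightarrow> thin {y. \<exists>z\<in>D. z i = x \<and> z k = y}"
    and "m \<le> n"
  shows "\<exists>D'. D' \<subseteq> D \<and> def_tuples \<M> n D' \<and> (\<forall>z\<in>D. \<exists>z'\<in>D'. z' i = z i) \<and>
    (\<forall>z\<in>D'. \<forall>z'\<in>D'. z i = z' i \<longrightarrow> (\<forall>k<m. z k = z' k))"
  using \<open>m \<le> n\<close>
proof (induction m)
  case 0
  then show ?case using D by blast
next
  case (Suc m)
  then obtain D' where D': "D' \<subseteq> D" "def_tuples \<M> n D'" "\<forall>z\<in>D. \<exists>z'\<in>D'. z' i = z i"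
    "\<forall>z\<in>D'. \<forall>z'\<in>D'. z i = z' i \<longrightarrow> (\<forall>k<m. z k = z' k)"
    by auto
  have m: "m < n" using Suc.prems by simp
  \<comment> \<open>One arbitrary parameter serves for the choice in all fibres, which keeps the
    selection definable.\<close>
  obtain p :: 'a where True by blast
  define D'' where "D'' = {z \<in> D'. (p \<le> z m \<and> (\<forall>z'\<in>D'. z' i = z i \<longrightarrow> p \<le> z' m \<longrightarrow> z m \<le> z' m)) \<or>
    (z m < p \<and> (\<forall>z'\<in>D'. z' i = z i \<longrightarrow> z' m \<le> z m))}"
  note defs = def_intros def_pred_ball_tuple[OF D'(2)] def_pred_bex_tuple[OF D'(2)]
    def_pred_tuple_mem[OF D'(2)]
  have "D'' \<subseteq> D'" by (auto simp: D''_def)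
  moreover have "def_tuples \<M> n D''" unfolding def_tuples_def
  proof
    show "D'' \<subseteq> tuples n" using \<open>D'' \<subseteq> D'\<close> D'(2) by (auto simp: def_tuples_def)
    show "def_pred \<M> (\<lambda>v. restrict v {..<n} \<in> D'')"
      unfolding D''_def mem_Collect_eq by (intro defs i m)
  qed
  moreover have "\<exists>z'\<in>D''. z' i = z i" if "z \<in> D" for z
  proof -
    obtain z0 where z0: "z0 \<in> D'" "z0 i = z i" using D'(3) \<open>z \<in> D\<close> by blast
    define A where "A = {y. \<exists>z'\<in>D'. z' i = z i \<and> z' m = y}"
    have "def_set A" unfolding A_def mem_Collect_eq by (intro defs i m)
    moreover have "thin A" by (rule thin_subset[OF thin[OF m]]) (use D'(1) in \<open>auto simp: A_def\<close>)
    moreover have "z0 m \<in> A" using z0 by (auto simp: A_def)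
    ultimately obtain y where y: "y \<in> A"
      "(p \<le> y \<and> (\<forall>z\<in>A. p \<le> z \<longrightarrow> y \<le> z)) \<or> (y < p \<and> (\<forall>z\<in>A. z \<le> y))"
      using thin_canonical_element by blast
    then obtain z' where "z' \<in> D'" "z' i = z i" "z' m = y" by (auto simp: A_def)
    then show ?thesis using y(2) unfolding D''_def A_def by (intro bexI[of _ z']) auto
  qed
  moreover have "z k = z' k" if z: "z \<in> D''" "z' \<in> D''" "z i = z' i" "k < Suc m" for z z' k
  proof (cases "k = m")
    case True
    \<comment> \<open>The two alternatives in \<open>D''\<close> cannot occur in the same fibre, and
      each determines the value.\<close>
    have "z m = z' m" using z(1-3) unfolding D''_def by (auto intro: antisym)
    then show ?thesis using True by simp
  next
    case False
    then show ?thesis using D'(4) z \<open>D'' \<subseteq> D'\<close> by (metis less_SucE subsetD)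
  qed
  ultimately show ?case using D'(1) by (intro exI[of _ D'']) blast
qed

text \<open>Over an interval the section is a tuple of functions. Moving to the right of
  \<open>x\<close> leaves the isolating box in some coordinate and through some side. As there are
  finitely many such pairs, one of them works on a whole germ at \<open>x\<close>, and then one
  works for all \<open>x\<close> in some interval, which \<open>no_jump_function\<close> rules
  out.\<close>

lemma thin_projection_of_section:
  assumes D: "def_tuples \<M> n D" and iso: "box_isolated n D" and i: "i < n"
    and func: "\<And>z z' k. z \<in> D \<Longrightarrow> z' \<in> D \<Longrightarrow> z i = z' i \<Longrightarrow> k < n \<Longrightarrow> z k = z' k"
  shows "thin {x. \<exists>z\<in>D. z i = x}"
proof (rule ccontr)
  assume "\<not> ?thesis"
  then obtain a b where ab: "a < b" "\<And>x. a < x \<Longrightarrow> x < b \<Longrightarrow> \<exists>z\<in>D. z i = x"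
    unfolding thin_def by auto
  \<comment> \<open>\<open>up\<close> tells whether the box is left through its upper or its lower
    side; reversing the order gives both cases the same form.\<close>
  define L :: "bool \<Rightarrow> 'a \<Rightarrow> 'a \<Rightarrow> bool" where "L = (\<lambda>up. if up then (<) else (>))"
  have L: "dir (L up)" for up by (simp add: L_def)
  note defs = def_intros def_pred_ball_tuple[OF D] def_pred_bex_tuple[OF D]
    def_pred_tuple_mem[OF D] def_pred_dir[OF L]
  define T where "T = (\<lambda>(k, up). {x. \<exists>z\<in>D. z i = x \<and> (\<exists>w. L up (z k) w \<and>
    (\<exists>u. x < u \<and> (\<forall>x'. x < x' \<longrightarrow> x' < u \<longrightarrow> (\<forall>z'\<in>D. z' i = x' \<longrightarrow> \<not> L up (z' k) w))))})"
  have T: "\<exists>ku\<in>{..<n} \<times> UNIV. x \<in> T ku" if x: "a < x" "x < b" for x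
  proof -
    obtain z where z: "z \<in> D" "z i = x" using ab(2)[OF x] by blast
    obtain l u where lu: "\<forall>k<n. l k < z k \<and> z k < u k"
      "\<forall>z'\<in>D. (\<forall>k<n. l k < z' k \<and> z' k < u k) \<longrightarrow> z' = z"
      using bspec[OF iso[unfolded box_isolated_def] z(1)] by (elim exE conjE)
    define w where "w = (\<lambda>k up. if up then u k else l k)"
    define B where "B = (\<lambda>(k, up). {x'. \<exists>z'\<in>D. z' i = x' \<and> \<not> L up (z' k) (w k up)})"
    have dB: "def_set (B ku)" if "ku \<in> {..<n} \<times> UNIV" for ku
    proof -
      obtain k up where ku: "ku = (k, up)" by fastforce
      then have k: "k < n" using that by simp
      show ?thesis unfolding ku B_def prod.case mem_Collect_eq by (intro defs i k)
    qed
    have "germ_in (<) x (\<Union>ku\<in>{..<n} \<times> UNIV. B ku)"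
      unfolding germ_in_def
    proof (intro exI[of _ b] conjI allI impI x)
      fix x' assume x': "x < x'" "x' < b"
      then obtain z' where z': "z' \<in> D" "z' i = x'" using ab(2)[of x'] x(1) by (meson less_trans)
      then have "z' \<noteq> z" using z(2) x'(1) by auto
      then obtain k where "k < n" "\<not> (l k < z' k \<and> z' k < u k)" using lu(2) z'(1) by blast
      then have "x' \<in> B (k, True) \<or> x' \<in> B (k, False)"
        using z' unfolding B_def L_def w_def by auto
      then show "x' \<in> (\<Union>ku\<in>{..<n} \<times> UNIV. B ku)" using \<open>k < n\<close> by blast
    qed
    then have "\<exists>ku\<in>{..<n} \<times> UNIV. germ_in (<) x (B ku)"
      by (intro germ_in_UN germ_dichotomy dB) auto
    then obtain k up where k: "k < n" and "germ_in (<) x (B (k, up))" by auto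
    then obtain c where c: "x < c" "\<And>x'. x < x' \<Longrightarrow> x' < c \<Longrightarrow> x' \<in> B (k, up)"
      unfolding germ_in_def by blast
    \<comment> \<open>\<open>B\<close> provides just one tuple over each point; functionality
      transfers the inequality to every tuple over it.\<close>
    have "\<not> L up (z' k) (w k up)" if z': "x < z' i" "z' i < c" "z' \<in> D" for z'
    proof -
      obtain z'' where "z'' \<in> D" "z'' i = z' i" "\<not> L up (z'' k) (w k up)"
        using c(2)[OF z'(1,2)] unfolding B_def by auto
      then show ?thesis using func[OF _ z'(3) _ k] by metis
    qed
    moreover have "L up (z k) (w k up)" using lu(1) k by (auto simp: L_def w_def)
    ultimately have "x \<in> T (k, up)" unfolding T_def using z c(1) by auto
    then show ?thesis using k by blast
  qed
  \<comment> \<open>Finitely many definable thin sets cannot cover an interval, so a single pair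
    \<open>(k, up)\<close> accounts for the jumps on a smaller one.\<close>
  have "\<not> thin (\<Union>ku\<in>{..<n} \<times> UNIV. T ku)" using T ab(1) unfolding thin_def by blast
  moreover have "def_set (T ku)" if "ku \<in> {..<n} \<times> UNIV" for ku
  proof -
    obtain k up where ku: "ku = (k, up)" by fastforce
    then have k: "k < n" using that by simp
    show ?thesis unfolding ku T_def prod.case mem_Collect_eq by (intro defs i k)
  qed
  ultimately obtain k up where k: "k < n" and "\<not> thin (T (k, up))"
    using thin_UN[of "{..<n} \<times> UNIV" T] by auto
  then obtain c d where cd: "c < d" "\<And>x. c < x \<Longrightarrow> x < d \<Longrightarrow> x \<in> T (k, up)"
    unfolding thin_def by blast
  define G where "G = (\<lambda>x y. \<exists>z\<in>D. z i = x \<and> z k = y)"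
  show False
  proof (rule no_jump_function[of G "L up" c d])
    show "def_rel G" unfolding G_def by (intro defs i k)
    show "y = y'" if "G x y" "G x y'" for x y y'
      using that func k unfolding G_def by metis
    show "\<exists>y w. G x y \<and> L up y w \<and>
      (\<exists>u. x < u \<and> (\<forall>x' y'. x < x' \<longrightarrow> x' < u \<longrightarrow> G x' y' \<longrightarrow> \<not> L up y' w))"
      if "c < x" "x < d" for x
      using cd(2)[OF that] unfolding T_def G_def by fastforce
  qed (use L cd in auto)
qed

text \<open>Induction on the set \<open>S\<close> of coordinates that are not constant on \<open>D\<close>.\<close>

lemma thin_coordinate_projection:
  assumes "finite S" "def_tuples \<M> n D" "box_isolated n D" "i < n"
    and "\<And>z z' k. z \<in> D \<Longrightarrow> z' \<in> D \<Longrightarrow> k < n \<Longrightarrow> k \<notin> S \<Longrightarrow> z k = z' k"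
  shows "thin {x. \<exists>z\<in>D. z i = x}"
  using assms
proof (induction S arbitrary: D i rule: finite_psubset_induct)
  case (psubset S)
  note D = psubset.prems(1) and i = psubset.prems(3)
  show ?case
  proof (cases "i \<in> S \<and> D \<noteq> {}")
    case False
    show ?thesis
    proof (cases "D = {}")
      case True
      then show ?thesis using thin_subset[OF thin_singleton] by auto
    next
      case ne: False
      then obtain z where "z \<in> D" by blast
      then have "{x. \<exists>z\<in>D. z i = x} \<subseteq> {z i}" using False ne psubset.prems(4) i by blast
      then show ?thesis using thin_subset[OF thin_singleton] by blast
    qed
  next
    case True
    \<comment> \<open>On a fibre coordinate \<open>i\<close> is constant too, so the induction
      hypothesis applies with \<open>S - {i}\<close>. Thin fibres are what the choice of a section
      requires.\<close>
    have fib: "thin {y. \<exists>z\<in>D. z i = x \<and> z k = y}" if k: "k < n" for x k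
    proof -
      define F where "F = {z \<in> D. z i = x}"
      have "thin {y. \<exists>z\<in>F. z k = y}"
      proof (rule psubset.IH[of "S - {i}"])
        show "S - {i} \<subset> S" using True by blast
        show "def_tuples \<M> n F" unfolding def_tuples_def
        proof
          show "F \<subseteq> tuples n" using D by (auto simp: F_def def_tuples_def)
          show "def_pred \<M> (\<lambda>v. restrict v {..<n} \<in> F)" unfolding F_def mem_Collect_eq
            by (intro def_intros def_pred_tuple_mem[OF D] i)
        qed
        show "box_isolated n F"
          by (rule box_isolated_subset[OF psubset.prems(2)]) (auto simp: F_def)
        show "z k = z' k" if "z \<in> F" "z' \<in> F" "k < n" "k \<notin> S - {i}" for z z' k
          using that psubset.prems(4) unfolding F_def by (cases "k = i") auto
      qed (rule k)
      then show ?thesis by (rule thin_subset) (auto simp: F_def)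
    qed
    obtain D' where D': "D' \<subseteq> D" "def_tuples \<M> n D'" "\<forall>z\<in>D. \<exists>z'\<in>D'. z' i = z i"
      "\<forall>z\<in>D'. \<forall>z'\<in>D'. z i = z' i \<longrightarrow> (\<forall>k<n. z k = z' k)"
      using definable_section_upto[OF D i fib order_refl] by blast
    have "thin {x. \<exists>z\<in>D'. z i = x}"
      using thin_projection_of_section[OF D'(2) box_isolated_subset[OF psubset.prems(2) D'(1)] i]
        D'(4) by blast
    then show ?thesis by (rule thin_subset) (use D'(3) in force)
  qed
qed

text \<open>The complement contains germs on both sides of \<open>x\<close>, which join to the
  isolating interval. As \<open>x\<close> is arbitrary, thin definable sets are closed and
  discrete.\<close>

lemma thin_isolated:
  assumes "def_set A" "thin A"
  shows "\<exists>l u. l < x \<and> x < u \<and> (\<forall>y\<in>A. l < y \<longrightarrow> y < u \<longrightarrow> y = x)"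
proof -
  have "germ_in (<) x (- A)" "germ_in (>) x (- A)"
    using germ_dichotomy[OF assms(1)] germ_in_not_thin assms(2) dir_less dir_greater by blast+
  then show ?thesis unfolding germ_in_def by (metis ComplD linorder_neqE)
qed

end

section \<open>Isolation of projected points from isolation in each coordinate\<close>

theorem theorem2p5:
  fixes \<M> :: "('a::{unbounded_dense_linorder, linorder_topology}, 'f, 'r) fo_structure"
    and n d :: nat
    and D :: "(nat \<Rightarrow> 'a) set"
    and \<pi> :: "(nat \<Rightarrow> 'a) \<Rightarrow> (nat \<Rightarrow> 'a)"
  assumes "definably_complete \<M>"
    and "locally_o_minimal \<M>"
    and "definable \<M> n D"
    and "discrete_subset n D"
    and "coordinate_projection n d \<pi>"
  shows "discrete_subset d (\<pi> ` D)"
proof -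
  interpret tame_structure \<M> by unfold_locales fact+
  have D: "def_tuples \<M> n D" using assms(3) by (rule definable_imp_def_tuples)
  then have Dn: "D \<subseteq> tuples n" by (simp add: def_tuples_def)
  have iso: "box_isolated n D" using discrete_imp_box_isolated[OF Dn assms(4)] .
  obtain \<sigma> where \<sigma>: "\<sigma> ` {..<d} \<subseteq> {..<n}" "\<And>x. x \<in> tuples n \<Longrightarrow> \<pi> x = (\<lambda>j\<in>{..<d}. x (\<sigma> j))"
    using assms(5) unfolding coordinate_projection_def by blast
  have "\<exists>l u. l < x \<and> x < u \<and> (\<forall>y\<in>{x. \<exists>z\<in>D. z i = x}. l < y \<longrightarrow> y < u \<longrightarrow> y = x)"
    if i: "i < n" for i x
  proof (rule thin_isolated)
    show "def_set {x. \<exists>z\<in>D. z i = x}" unfolding mem_Collect_eq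
      by (intro def_intros def_pred_bex_tuple[OF D] i)
    \<comment> \<open>The induction starts with all coordinates in \<open>S\<close>, so that none
      has to be constant on \<open>D\<close>.\<close>
    show "thin {x. \<exists>z\<in>D. z i = x}"
      by (rule thin_coordinate_projection[OF finite_lessThan[of n] D iso i]) simp
  qed
  then obtain l u where lu: "\<And>i x. i < n \<Longrightarrow> l i x < x \<and> x < u i x \<and>
      (\<forall>z\<in>D. l i x < z i \<longrightarrow> z i < u i x \<longrightarrow> z i = x)"
    by (simp only: bex_simps ball_simps mem_Collect_eq) metis
  show ?thesis
  proof (rule box_isolated_imp_discrete)
    show "\<pi> ` D \<subseteq> tuples d"
    proof
      fix y assume "y \<in> \<pi> ` D"
      then obtain z where "z \<in> tuples n" "y = \<pi> z" using Dn by blast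
      then show "y \<in> tuples d" using \<sigma>(2) by (simp add: tuples_def)
    qed
    \<comment> \<open>The isolating box around \<open>\<pi> z\<close> is the product of the
      intervals that isolate its entries in the coordinate images of \<open>D\<close>.\<close>
    show "box_isolated d (\<pi> ` D)" unfolding box_isolated_def
    proof (clarify, intro exI conjI allI impI ballI)
      fix z j assume z: "z \<in> D" "j < d"
      have "\<sigma> j < n" "\<pi> z j = z (\<sigma> j)" using \<sigma> z Dn by auto
      then show "l (\<sigma> j) (\<pi> z j) < \<pi> z j" "\<pi> z j < u (\<sigma> j) (\<pi> z j)" using lu by auto
    next
      fix z y assume z: "z \<in> D" and y: "y \<in> \<pi> ` D"
        and box: "\<forall>j<d. l (\<sigma> j) (\<pi> z j) < y j \<and> y j < u (\<sigma> j) (\<pi> z j)"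
      obtain z' where z': "z' \<in> D" "y = \<pi> z'" using y by blast
      have "y j = \<pi> z j" if j: "j < d" for j
      proof -
        have "\<sigma> j < n" "y j = z' (\<sigma> j)" using \<sigma> j z' Dn by auto
        then show ?thesis using lu box j z'(1) by metis
      qed
      moreover have "\<pi> z = (\<lambda>j\<in>{..<d}. z (\<sigma> j))" "y = (\<lambda>j\<in>{..<d}. z' (\<sigma> j))"
        using \<sigma>(2) Dn z z' by auto
      ultimately show "y = \<pi> z" by (auto simp: fun_eq_iff restrict_def)
    qed
  qed
qed

end
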